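(* For $n=q^m-1$, let $C$ be a cyclic code of length $n$ over $\mathbb{F}_q$. Let $\{i_1,\ldots,i_t\}$ be the set of all leaders of $q$-cyclotomic cosets modulo $n$, and $T=\{\alpha^{i_j} : 1\le j\le t\}$. Then $h(C)=1$ if and only if the following holds. (i) There exists a unique $1\le j\le t$ such that $|B_{i_j}|=1$ and $B_{i_j}\cap B_{-i_j}=\emptyset$. (ii) $\mathrm{BZ}(C^\perp)=T_1\cup\{\alpha^{i_j}\}$, where $T_1\subset T$ satisfies: for any $\alpha^{i_h}\in T_1$, we have either $B_{i_h}=B_{-i_h}$ or $\alpha^{-i_h}\in T_1$.
   Context: Here $q$ is a prime power, $m$ is a positive integer, and $\alpha$ is a primitive $n$-th root of unity over $\mathbb{F}_q$. A linear code of length $n$ over $\mathbb{F}_q$ is a subspace of $\mathbb{F}_q^n$; $C^\perp$ denotes its dual under the Euclidean inner product. $\mathrm{Hull}(C)=C\cap C^\perp$ and $h(C)$ is the dimension of $\mathrm{Hull}(C)$ over $\mathbb{F}_q$. A linear code is cyclic if every cyclic shift of a codeword is a codeword; identifying $(c_0,\ldots,c_{n-1})$ with $\sum c_ix^i$, a cyclic code is an ideal of $\mathbb{F}_q[x]/(x^n-1)$, and its generator polynomial is the monic divisor $g(x)$ of $x^n-1$ generating it. The dual of a cyclic code is cyclic. The $q$-cyclotomic coset of an integer $a$ modulo $n$ is $B_a=\{a,aq,\ldots,aq^{\delta_a-1}\}$ (reduced modulo $n$), where $\delta_a=|B_a|$ is the smallest positive integer with $aq^{\delta_a}\equiv a \pmod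 n$. These cosets partition $\mathbb{Z}_n$; the set of coset leaders contains exactly one representative of each coset. The minimal polynomial of $\alpha^i$ over $\mathbb{F}_q$ is $m_{\alpha^i}(x)=\prod_{s\in B_i}(x-\alpha^s)$. If the generator polynomial of $C^\perp$ is $\prod_{j\in S}m_{\alpha^{i_j}}(x)$ with $S\subseteq\{1,\ldots,t\}$, then the basic dual zero of $C$ is $\mathrm{BZ}(C^\perp)=\{\alpha^{i_j}: j\in S\}$. The index $j$ in (ii) is the one given by (i). The condition $\alpha^{-i_h}\in T_1$ is understood up to the choice of coset representative: it means $\alpha^{i_k}\in T_1$ for the leader $i_k$ with $i_k\in B_{-i_h}$.
   Formalization: The uniqueness of j is taken over (i) and (ii) jointly: there is a unique j satisfying both; uniqueness in (i) alone can never hold, because the leader of the coset of -i_j satisfies (i) as well. *)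

theory Defs
  imports
    "Jordan_Normal_Form.VS_Connect"
    "HOL-Computational_Algebra.Polynomial"
    "HOL-Library.Cardinality"
    "HOL-Number_Theory.Cong"
begin

section \<open>Linear and cyclic codes\<close>

text \<open>
  The field with \<open>q\<close> elements is a type \<open>'a :: {field, finite}\<close> with \<open>q = CARD('a)\<close>; words of
  length \<open>n\<close> are the elements of \<^term>\<open>carrier_vec n\<close>.
\<close>

definition linear_code :: "nat \<Rightarrow> 'a :: field vec set \<Rightarrow> bool" where
  "linear_code n C \<longleftrightarrow> VectorSpace.subspace class_ring C (module_vec TYPE('a) n)"

abbreviation dual_code :: "nat \<Rightarrow> 'a :: field vec set \<Rightarrow> 'a vec set" where
  "dual_code n C \<equiv> vec_module.orthogonal_complement n C"

definition code_hull :: "nat \<Rightarrow> 'a :: field vec set \<Rightarrow> 'a vec set" where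
  "code_hull n C = C \<inter> dual_code n C"

definition code_dim :: "nat \<Rightarrow> 'a :: field vec set \<Rightarrow> nat" where
  "code_dim n C = vectorspace.dim class_ring ((module_vec TYPE('a) n)\<lparr>carrier := C\<rparr>)"

definition hull_dim :: "nat \<Rightarrow> 'a :: field vec set \<Rightarrow> nat" where
  "hull_dim n C = code_dim n (code_hull n C)"

text \<open>\<open>(c\<^sub>0, \<dots>, c\<^bsub>n-1\<^esub>)\<close> is sent to \<open>(c\<^bsub>n-1\<^esub>, c\<^sub>0, \<dots>, c\<^bsub>n-2\<^esub>)\<close>.\<close>

definition cyclic_shift :: "nat \<Rightarrow> 'a vec \<Rightarrow> 'a vec" where
  "cyclic_shift n c = vec n (\<lambda>k. c $ ((k + n - 1) mod n))"

definition cyclic_code :: "nat \<Rightarrow> 'a :: field vec set \<Rightarrow> bool" where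
  "cyclic_code n C \<longleftrightarrow> linear_code n C \<and> (\<forall>c \<in> C. cyclic_shift n c \<in> C)"

definition word_poly :: "'a :: comm_monoid_add vec \<Rightarrow> 'a poly" where
  "word_poly c = (\<Sum>k < dim_vec c. monom (c $ k) k)"

text \<open>
  Elements of \<open>F[x]/(x\<^sup>n - 1)\<close> are represented by their remainders modulo \<open>x\<^sup>n - 1\<close>, so that
  \<open>{(g * f) mod (x\<^sup>n - 1) | f}\<close> is the ideal generated by \<open>g\<close>. For the zero code the generator
  polynomial is \<open>x\<^sup>n - 1\<close> itself.
\<close>

definition is_generator_poly :: "nat \<Rightarrow> 'a :: field vec set \<Rightarrow> 'a poly \<Rightarrow> bool" where
  "is_generator_poly n C g \<longleftrightarrow>
     lead_coeff g = 1 \<and> g dvd (monom 1 n - 1) \<and>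
     word_poly ` C = {(g * f) mod (monom 1 n - 1) | f. True}"

definition generator_poly :: "nat \<Rightarrow> 'a :: field vec set \<Rightarrow> 'a poly" where
  "generator_poly n C = (THE g. is_generator_poly n C g)"

section \<open>Cyclotomic cosets\<close>

definition coset_size :: "nat \<Rightarrow> nat \<Rightarrow> int \<Rightarrow> nat" where
  "coset_size q n a = (LEAST d. d > 0 \<and> [a * int q ^ d = a] (mod int n))"

definition cyc_coset :: "nat \<Rightarrow> nat \<Rightarrow> int \<Rightarrow> int set" where
  "cyc_coset q n a = (\<lambda>k. (a * int q ^ k) mod int n) ` {..< coset_size q n a}"

text \<open>
  \<open>i 1, \<dots>, i t\<close> enumerates, without repetition, a set of representatives of the cosets; a leader
  need not be the smallest element of its coset.
\<close>

definition coset_leaders :: "nat \<Rightarrow> nat \<Rightarrow> nat \<Rightarrow> (nat \<Rightarrow> int) \<Rightarrow> bool" where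
  "coset_leaders q n t i \<longleftrightarrow>
     i ` {1..t} \<subseteq> {0..<int n} \<and>
     (\<forall>a \<in> {0..<int n}. \<exists>!j. j \<in> {1..t} \<and> i j \<in> cyc_coset q n a)"

section \<open>Zeros of cyclic codes\<close>

definition primitive_root_of_unity :: "nat \<Rightarrow> 'b :: field \<Rightarrow> bool" where
  "primitive_root_of_unity n \<alpha> \<longleftrightarrow> \<alpha> ^ n = 1 \<and> (\<forall>k. 0 < k \<and> k < n \<longrightarrow> \<alpha> ^ k \<noteq> 1)"

text \<open>
  The minimal polynomial of \<open>\<alpha>\<^sup>a\<close> over the field with \<open>q\<close> elements, as a polynomial over the
  extension field containing \<open>\<alpha>\<close>.
\<close>

definition min_poly_root :: "nat \<Rightarrow> nat \<Rightarrow> 'b :: field \<Rightarrow> int \<Rightarrow> 'b poly" where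
  "min_poly_root q n \<alpha> a = (\<Prod>s \<in> cyc_coset q n a. [:- (\<alpha> powi s), 1:])"

text \<open>
  \<open>basic_zeros emb \<alpha> n t i D\<close> is \<open>BZ(D)\<close>; the basic dual zero of \<open>C\<close> is \<open>BZ\<close> of the dual of \<open>C\<close>.
  The field embedding \<open>emb\<close> carries the generator polynomial into the extension field.
\<close>

definition basic_zeros ::
  "('a :: {field, finite} \<Rightarrow> 'b :: field) \<Rightarrow> 'b \<Rightarrow> nat \<Rightarrow> nat \<Rightarrow> (nat \<Rightarrow> int) \<Rightarrow> 'a vec set \<Rightarrow> 'b set"
  where
  "basic_zeros emb \<alpha> n t i D =
     (\<lambda>j. \<alpha> powi i j) `
       (THE S. S \<subseteq> {1..t} \<and>
          map_poly emb (generator_poly n D) = (\<Prod>j \<in> S. min_poly_root CARD('a) n \<alpha> (i j)))"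

end

theory Submission
  imports Defs "Jordan_Normal_Form.Char_Poly"
begin

text \<open>
  Let \<open>Z\<close> and \<open>W\<close> be the sets of exponents of the zeros of \<open>C\<close> and of its dual. By Parseval's
  identity for the transform \<open>c \<mapsto> (c(\<alpha>\<^sup>s))\<^sub>s\<close>, a word \<open>d\<close> is orthogonal to \<open>C\<close> iff
  \<open>c(\<alpha>\<^sup>s) d(\<alpha>\<^bsup>-s\<^esup>) = 0\<close> for all \<open>c \<in> C\<close> and all \<open>s\<close>, so \<open>s \<in> W\<close> iff \<open>-s \<notin> Z\<close>. The zeros of the hull
  are \<open>Z \<union> W\<close>, and the dimension of a cyclic code is \<open>n\<close> minus its number of zeros, so \<open>h(C)\<close> counts
  the \<open>s \<in> W\<close> with \<open>-s \<notin> W\<close>. These \<open>s\<close> form a union of cyclotomic cosets; hence \<open>h(C) = 1\<close> iff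
  exactly one coset in \<open>W\<close> has its opposite outside \<open>W\<close>, and that coset is a singleton.
\<close>

section \<open>Polynomials with distinct linear factors\<close>

text \<open>The quantifier "there exists a unique j" has to range over (i) and (ii) together: a
  coset and its opposite satisfy (i) simultaneously and are then different, so no index is ever
  unique for (i) alone. All roots live in an arbitrary field \<open>'b\<close> with an embedding of
  F_q. Since alpha has n distinct powers there, x^n - 1 splits in \<open>'b\<close> into distinct
  linear factors, and monic divisors are determined by their zeros. The form n = q^m - 1 enters
  twice: n = -1 in F_q, so n is invertible and the transform can be inverted; and q^m = 1 modulo n,
  so multiplication by q permutes the residues and its orbits, the cosets, partition them.
  Dimensions are found by counting words, because |C| = q^dim determines dim.\<close>

lemma prod_linear_dvd:
  fixes p :: "'a :: field poly"
  assumes "finite R" "\<And>r. r \<in> R \<Longrightarrow> poly p r = 0"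
  shows "(\<Prod>r\<in>R. [:- r, 1:]) dvd p"
  using assms
proof (induction R rule: finite_induct)
  case (insert r R)
  then obtain k where k: "p = (\<Prod>r\<in>R. [:- r, 1:]) * k" by auto
  have "poly (\<Prod>r\<in>R. [:- r, 1:]) r \<noteq> 0"
    using insert.hyps by (auto simp: poly_prod)
  with insert.prems[of r] k have "poly k r = 0" by auto
  then have "[:- r, 1:] dvd k" by (simp add: poly_eq_0_iff_dvd)
  then show ?case
    unfolding k prod.insert[OF insert.hyps] mult.commute[of "[:- r, 1:]"]
    by (rule mult_dvd_mono[OF dvd_refl])
qed simp

lemma degree_prod_linear [simp]: "degree (\<Prod>r\<in>R. [:- r, 1 :: 'a :: field:]) = card R"
  by (subst degree_prod_eq_sum_degree) auto

lemma monic_prod_linear: "lead_coeff (\<Prod>r\<in>R. [:- r, 1 :: 'a :: field:]) = 1"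
  by (subst lead_coeff_prod) simp

lemma coeff_prod_linear_card [simp]: "coeff (\<Prod>r\<in>R. [:- r, 1 :: 'a :: field:]) (card R) = 1"
  using monic_prod_linear[of R] by simp

lemma monic_dvd_degree_eq:
  fixes p p' :: "'a :: field poly"
  assumes "p' dvd p" "degree p \<le> degree p'" "lead_coeff p = 1" "lead_coeff p' = 1"
  shows "p = p'"
proof -
  obtain k where k: "p = p' * k" using assms(1) by (elim dvdE)
  have "p \<noteq> 0" using assms by auto
  with k have "degree k = 0" using assms(2) by (auto simp: degree_mult_eq)
  then obtain c where c: "k = [:c:]" by (auto elim: degree_eq_zeroE)
  then show ?thesis using k assms(3,4) by (cases "c = 0") auto
qed

text \<open>Degree count: every element of R is a root of p or of the cofactor k, neither has more
  roots in R than its degree, and the two degrees add up to |R|. Hence p has exactly deg p roots in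
  R.\<close>

lemma monic_dvd_prod_linear:
  fixes p :: "'a :: field poly"
  assumes "finite R" "p dvd (\<Prod>r\<in>R. [:- r, 1:])" "lead_coeff p = 1"
  shows "p = (\<Prod>r\<in>{r \<in> R. poly p r = 0}. [:- r, 1:])"
proof (rule monic_dvd_degree_eq)
  let ?Z = "\<lambda>p. {r \<in> R. poly p r = 0}"
  obtain k where k: "(\<Prod>r\<in>R. [:- r, 1:]) = p * k" using assms(2) by (elim dvdE)
  have nz: "(\<Prod>r\<in>R. [:- r, 1:]) \<noteq> 0" using assms(1) by auto
  have pk: "p \<noteq> 0" "k \<noteq> 0" using nz unfolding k by simp_all
  have "poly p r = 0 \<or> poly k r = 0" if "r \<in> R" for r
  proof -
    have "poly (\<Prod>r\<in>R. [:- r, 1:]) r = 0"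
      unfolding poly_prod using that assms(1) by (intro prod_zero bexI[of _ r]) simp_all
    then show ?thesis unfolding k by simp
  qed
  then have "card R \<le> card (?Z p \<union> ?Z k)" using assms(1) by (intro card_mono) auto
  also have "\<dots> \<le> card (?Z p) + card (?Z k)" by (rule card_Un_le)
  finally have "card R \<le> card (?Z p) + card (?Z k)" .
  moreover have "card R = degree p + degree k"
    using degree_mult_eq[OF pk] unfolding k[symmetric] by simp
  moreover have "card (?Z k) \<le> degree k"
  proof -
    have "(\<Prod>r\<in>?Z k. [:- r, 1:]) dvd k" by (rule prod_linear_dvd) (simp_all add: assms(1))
    then show ?thesis using dvd_imp_degree_le[OF _ pk(2)] by fastforce
  qed
  ultimately show "degree p \<le> degree (\<Prod>r\<in>?Z p. [:- r, 1:])" by simp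
  show "(\<Prod>r\<in>?Z p. [:- r, 1:]) dvd p" by (rule prod_linear_dvd) (simp_all add: assms(1))
qed (rule assms(3) monic_prod_linear)+

section \<open>The Frobenius endomorphism\<close>

text \<open>Multiplication by a nonzero x permutes the nonzero elements, so their product absorbs
  the factor x^(q-1).\<close>

lemma power_card_field:
  fixes x :: "'a :: {field, finite}"
  shows "x ^ CARD('a) = x"
proof (cases "x = 0")
  case False
  have "x * (\<Prod>y\<in>UNIV-{0}. x * y) = x * x ^ (CARD('a) - 1) * \<Prod>(UNIV-{0})"
    by (simp add: prod.distrib mult_ac)
  also have "x * x ^ (CARD('a) - 1) = x ^ CARD('a)"
    by (metis power_Suc Suc_diff_1 finite_UNIV_card_ge_0 finite)
  also have "(\<Prod>y\<in>UNIV-{0}. x * y) = (\<Prod>y\<in>UNIV-{0}. y)"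
    by (rule prod.reindex_bij_witness[of _ "\<lambda>y. y / x" "\<lambda>y. x * y"]) (use False in auto)
  finally show ?thesis by simp
qed (simp add: power_0_left)

lemma card_field_gt_1: "CARD('a :: {field, finite}) > 1"
proof -
  have "card {0, 1 :: 'a} \<le> CARD('a)" by (rule card_mono) auto
  then show ?thesis by simp
qed

text \<open>
  The polynomial \<open>(X + 1)\<^sup>q - X\<^sup>q - 1\<close> has degree less than \<open>q\<close> and vanishes on all of the field
  with \<open>q\<close> elements, hence is zero.
\<close>

lemma of_nat_card_choose_eq_0:
  assumes "0 < k" "k < CARD('a :: {field, finite})"
  shows "of_nat (CARD('a) choose k) = (0 :: 'a)"
proof -
  let ?q = "CARD('a)"
  define p :: "'a poly" where "p = (\<Sum>k\<in>{0<..<?q}. monom (of_nat (?q choose k)) k)"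
  have q: "?q > 0" by simp
  have "poly p x = 0" for x
  proof -
    have split: "{..?q} = insert 0 (insert ?q {0<..<?q})" using q by auto
    have "x + 1 = (x + 1) ^ ?q" by (simp add: power_card_field)
    also have "\<dots> = (\<Sum>k\<le>?q. of_nat (?q choose k) * x ^ k)" by (simp add: binomial_ring)
    also have "\<dots> = 1 + (x ^ ?q + poly p x)"
      unfolding split using q by (simp add: p_def poly_sum poly_monom)
    finally show ?thesis by (simp add: power_card_field algebra_simps)
  qed
  then have "{x. poly p x = 0} = UNIV" by auto
  moreover have "degree p < ?q"
    unfolding p_def by (rule degree_sum_less[OF _ q])
      (meson degree_monom_le greaterThanLessThan_iff le_less_trans)
  ultimately have "p = 0"
    using card_poly_roots_bound[of p] by (metis not_le)
  then have "coeff p k = 0" by simp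
  then show ?thesis using assms by (simp add: p_def coeff_sum coeff_monom sum.delta)
qed

lemma of_nat_card_eq_0: "of_nat CARD('a) = (0 :: 'a :: {field, finite})"
  using of_nat_card_choose_eq_0[of 1, where 'a = 'a] card_field_gt_1[where 'a = 'a] by simp

section \<open>Vector spaces over finite fields\<close>

text \<open>Coordinates with respect to a basis biject V with the functions from the basis to K.
  Over a finite field a dimension can thus be read off a cardinality.\<close>

lemma (in vectorspace) card_carrier_eq_power_dim:
  assumes "finite (carrier V)"
  shows "card (carrier V) = card (carrier K) ^ dim"
proof -
  have gen: "span (carrier V) = carrier V"
    using in_own_span[of "carrier V"] span_is_subset2[of "carrier V"] by auto
  have "fin_dim" unfolding fin_dim_def using assms gen by auto
  then obtain \<beta> where \<beta>: "finite \<beta>" "basis \<beta>"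
    using finite_basis_exists by auto
  then have sub: "\<beta> \<subseteq> carrier V" by (auto simp: basis_def)
  have ex1: "\<exists>!a. a \<in> \<beta> \<rightarrow>\<^sub>E carrier K \<and> lincomb a \<beta> = v" if "v \<in> carrier V" for v
    using basis_criterion[OF \<beta>(1) sub, THEN iffD1, OF \<beta>(2)] that by simp
  have closed: "lincomb a \<beta> \<in> carrier V" if "a \<in> \<beta> \<rightarrow>\<^sub>E carrier K" for a
    using that sub by (intro lincomb_closed) (auto simp: PiE_def)
  have "bij_betw (\<lambda>a. lincomb a \<beta>) (\<beta> \<rightarrow>\<^sub>E carrier K) (carrier V)"
  proof (rule bij_betwI')
    fix a b assume ab: "a \<in> \<beta> \<rightarrow>\<^sub>E carrier K" "b \<in> \<beta> \<rightarrow>\<^sub>E carrier K"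
    show "lincomb a \<beta> = lincomb b \<beta> \<longleftrightarrow> a = b"
      using ex1_implies_ex ex1[OF closed[OF ab(1)]] ab by (auto dest: ex1_implies_ex)
  next
    fix v assume "v \<in> carrier V"
    then show "\<exists>a \<in> \<beta> \<rightarrow>\<^sub>E carrier K. v = lincomb a \<beta>" using ex1 by metis
  qed (rule closed)
  then have "card (carrier V) = card (\<beta> \<rightarrow>\<^sub>E carrier K)"
    by (metis bij_betw_same_card)
  then show ?thesis
    using \<beta> dim_basis by (simp add: card_PiE)
qed

lemma linear_codeD:
  assumes "linear_code n C"
  shows "C \<subseteq> carrier_vec n" "0\<^sub>v n \<in> C"
    "\<And>c d. c \<in> C \<Longrightarrow> d \<in> C \<Longrightarrow> c + d \<in> C"
    "\<And>a c. c \<in> C \<Longrightarrow> a \<cdot>\<^sub>v c \<in> C"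
  using assms unfolding linear_code_def VectorSpace.subspace_def submodule_def
  by (auto simp: module_vec_simps class_ring_simps)

lemma linear_codeI:
  assumes "C \<subseteq> carrier_vec n" "0\<^sub>v n \<in> C"
    "\<And>c d. c \<in> C \<Longrightarrow> d \<in> C \<Longrightarrow> c + d \<in> C"
    "\<And>a c. c \<in> C \<Longrightarrow> a \<cdot>\<^sub>v c \<in> C"
  shows "linear_code n (C :: 'a :: field vec set)"
  using assms vec_vs vec_module unfolding linear_code_def VectorSpace.subspace_def submodule_def
  by (auto simp: module_vec_simps class_ring_simps)

lemma linear_code_Int:
  assumes "linear_code n C" "linear_code n D"
  shows "linear_code n (C \<inter> D :: 'a :: field vec set)"
proof (rule linear_codeI)
  show "C \<inter> D \<subseteq> carrier_vec n" using linear_codeD(1)[OF assms(1)] by auto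
  show "0\<^sub>v n \<in> C \<inter> D" using linear_codeD(2)[OF assms(1)] linear_codeD(2)[OF assms(2)] by simp
  show "c + d \<in> C \<inter> D" if "c \<in> C \<inter> D" "d \<in> C \<inter> D" for c d
    using that linear_codeD(3)[OF assms(1)] linear_codeD(3)[OF assms(2)] by simp
  show "a \<cdot>\<^sub>v c \<in> C \<inter> D" if "c \<in> C \<inter> D" for a c
    using that linear_codeD(4)[OF assms(1)] linear_codeD(4)[OF assms(2)] by simp
qed

lemma card_linear_code:
  fixes C :: "'a :: {field, finite} vec set"
  assumes "linear_code n C" "finite C"
  shows "card C = CARD('a) ^ code_dim n C"
proof -
  interpret vectorspace "class_ring :: 'a ring" "(module_vec TYPE('a) n)\<lparr>carrier := C\<rparr>"
    using vectorspace.subspace_is_vs[OF vec_vs] assms(1) by (simp add: linear_code_def)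
  show ?thesis using card_carrier_eq_power_dim assms(2)
    by (simp add: code_dim_def class_ring_simps)
qed

section \<open>Words as polynomials\<close>

abbreviation cyc_modulus :: "nat \<Rightarrow> 'a :: comm_ring_1 poly" where
  "cyc_modulus n \<equiv> monom 1 n - 1"

text \<open>Reducing first makes this linear and total on F[x]; on words it inverts
  \<open>word_poly\<close>, so codes can be studied through ideals of F[x] itself.\<close>

definition poly_word :: "nat \<Rightarrow> 'a :: field poly \<Rightarrow> 'a vec" where
  "poly_word n f = vec n (coeff (f mod cyc_modulus n))"

lemma degree_cyc_modulus:
  assumes "n > 0"
  shows "degree (cyc_modulus n :: 'a :: field poly) = n" "cyc_modulus n \<noteq> (0 :: 'a poly)"
proof -
  have "monom 1 n - 1 = monom 1 n + (- 1 :: 'a poly)" by simp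
  also have "degree \<dots> = n"
    using assms by (subst degree_add_eq_left) (auto simp: degree_monom_eq)
  finally show "degree (cyc_modulus n :: 'a poly) = n" .
  then show "cyc_modulus n \<noteq> (0 :: 'a poly)" using assms by auto
qed

lemma lead_coeff_cyc_modulus:
  "n > 0 \<Longrightarrow> lead_coeff (cyc_modulus n :: 'a :: field poly) = 1"
  by (subst degree_cyc_modulus) auto

lemma coeff_word_poly: "coeff (word_poly c) k = (if k < dim_vec c then c $ k else 0)"
  by (simp add: word_poly_def coeff_sum)

lemma word_poly_inj: "dim_vec c = dim_vec d \<Longrightarrow> word_poly c = word_poly d \<Longrightarrow> c = d"
  by (rule eq_vecI) (metis coeff_word_poly)+

lemma degree_word_poly_less: "dim_vec c > 0 \<Longrightarrow> degree (word_poly c) < dim_vec c"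
  unfolding word_poly_def by (rule degree_sum_less) (auto intro: le_less_trans[OF degree_monom_le])

lemma word_poly_mod:
  assumes "c \<in> carrier_vec n" "n > 0"
  shows "word_poly c mod cyc_modulus n = (word_poly c :: 'a :: field poly)"
  using degree_word_poly_less[of c] assms degree_cyc_modulus(1)[where 'a = 'a]
  by (intro mod_poly_less) auto

lemma poly_word_carrier [simp]: "poly_word n f \<in> carrier_vec n"
  by (simp add: poly_word_def)

lemma dim_poly_word [simp]: "dim_vec (poly_word n f) = n"
  by (simp add: poly_word_def)

lemma word_poly_poly_word:
  assumes "n > 0"
  shows "word_poly (poly_word n f) = f mod cyc_modulus n"
proof (rule poly_eqI)
  fix k
  have "degree (f mod cyc_modulus n) < n"
    using degree_mod_less'[of "cyc_modulus n" f] degree_cyc_modulus[OF assms, where 'a = 'a] assms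
    by (cases "f mod cyc_modulus n = 0") auto
  then show "coeff (word_poly (poly_word n f)) k = coeff (f mod cyc_modulus n) k"
    by (simp add: coeff_word_poly poly_word_def coeff_eq_0)
qed

lemma poly_word_word_poly: "c \<in> carrier_vec n \<Longrightarrow> n > 0 \<Longrightarrow> poly_word n (word_poly c) = c"
  by (rule word_poly_inj) (auto simp: word_poly_poly_word word_poly_mod)

lemma poly_word_add: "poly_word n (f + g) = poly_word n f + poly_word n g"
  by (rule eq_vecI) (auto simp: poly_word_def poly_mod_add_left)

lemma poly_word_0: "poly_word n 0 = 0\<^sub>v n"
  by (rule eq_vecI) (auto simp: poly_word_def)

lemma poly_word_smult: "poly_word n (smult a f) = a \<cdot>\<^sub>v poly_word n f"
  by (rule eq_vecI) (auto simp: poly_word_def mod_smult_left)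

lemma poly_word_mod_cong:
  "f mod cyc_modulus n = g mod cyc_modulus n \<Longrightarrow> poly_word n f = poly_word n g"
  by (simp add: poly_word_def)

lemma cyclic_shift_eq:
  assumes "c \<in> carrier_vec n" "n > 0"
  shows "cyclic_shift n c = poly_word n (monom 1 1 * word_poly c)"
proof (rule word_poly_inj)
  let ?l = "c $ (n - 1)"
  \<comment> \<open>Multiplication by x moves the last entry to x^n; subtracting that entry times
    x^n - 1 wraps it around to position 0.\<close>
  have eq: "monom 1 1 * word_poly c = word_poly (cyclic_shift n c) + [:?l:] * cyc_modulus n"
  proof (rule poly_eqI)
    fix k
    have sh: "coeff (word_poly (cyclic_shift n c)) k =
        (if k < n then if k = 0 then ?l else c $ (k - 1) else 0)"
    proof (cases "0 < k \<and> k < n")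
      case True
      then have "(k + n - 1) mod n = k - 1"
        by (metis Nat.add_diff_assoc2 One_nat_def Suc_leI less_imp_diff_less mod_add_self2 mod_less)
      then show ?thesis using True by (simp add: coeff_word_poly cyclic_shift_def)
    qed (use assms in \<open>auto simp: coeff_word_poly cyclic_shift_def\<close>)
    have "coeff (monom 1 1 * word_poly c) k =
        (if k = 0 then 0 else if k - 1 < n then c $ (k - 1) else 0)"
      using assms by (cases k) (auto simp: coeff_monom_mult coeff_word_poly)
    moreover have "coeff (word_poly (cyclic_shift n c) + [:?l:] * cyc_modulus n) k =
        (if k < n then if k = 0 then ?l else c $ (k - 1) else 0) +
        ?l * ((if k = n then 1 else 0) - (if k = 0 then 1 else 0))"
      by (simp add: sh)
    ultimately show "coeff (monom 1 1 * word_poly c) k =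
        coeff (word_poly (cyclic_shift n c) + [:?l:] * cyc_modulus n) k"
      using assms(2) by auto
  qed
  have "cyclic_shift n c \<in> carrier_vec n" by (simp add: cyclic_shift_def)
  then show "word_poly (cyclic_shift n c) = word_poly (poly_word n (monom 1 1 * word_poly c))"
    using assms(2) unfolding word_poly_poly_word[OF assms(2)] eq
    by (simp add: poly_mod_add_left word_poly_mod mod_smult_left)
qed (simp add: cyclic_shift_def poly_word_def)

section \<open>Generator polynomials\<close>

text \<open>Horner's scheme: \<open>pCons a f\<close> is a + x f, and multiplication by x is a
  cyclic shift by \<open>cyclic_shift_eq\<close>.\<close>

lemma cyclic_code_mult:
  assumes "cyclic_code n C" "n > 0" "c \<in> C"
  shows "poly_word n (f * word_poly c) \<in> C"
proof (induction f)
  case 0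
  then show ?case
    using linear_codeD(2)[of n C] assms(1) by (simp add: cyclic_code_def poly_word_0)
next
  case (pCons a f)
  note lin = linear_codeD[of n C]
  have C: "linear_code n C" "\<And>c. c \<in> C \<Longrightarrow> cyclic_shift n c \<in> C"
    using assms(1) by (auto simp: cyclic_code_def)
  have c: "c \<in> carrier_vec n" using lin(1) C(1) assms(3) by auto
  have "poly_word n (monom 1 1 * (f * word_poly c)) = cyclic_shift n (poly_word n (f * word_poly c))"
    by (subst cyclic_shift_eq)
      (auto simp: assms word_poly_poly_word mod_mult_right_eq intro!: poly_word_mod_cong)
  moreover have "pCons a f * word_poly c = smult a (word_poly c) + monom 1 1 * (f * word_poly c)"
    by (simp add: monom_altdef)
  ultimately have "poly_word n (pCons a f * word_poly c) =
      a \<cdot>\<^sub>v c + cyclic_shift n (poly_word n (f * word_poly c))"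
    using c assms(2) by (simp add: poly_word_add poly_word_smult poly_word_word_poly)
  then show ?case
    using lin(3,4) C pCons.IH assms(3) by auto
qed

text \<open>F[x] is Euclidean: a monic element of least degree in a nonzero ideal divides every
  element of it.\<close>

lemma generator_poly_exists:
  assumes "cyclic_code n C" "n > 0"
  shows "\<exists>g. is_generator_poly n C g"
proof -
  \<comment> \<open>The preimage of C in F[x]. It contains x^n - 1, so it is nonzero even when C is
    the zero code, and its generator divides x^n - 1.\<close>
  define I where "I = {f. poly_word n f \<in> C}"
  have lin: "linear_code n C" using assms(1) by (simp add: cyclic_code_def)
  note C = linear_codeD[OF lin]
  have zero: "f \<in> I" if "cyc_modulus n dvd f" for f
    using that C(2) poly_word_mod_cong[of f n 0] by (simp add: I_def poly_word_0 dvd_eq_mod_eq_0)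
  have mult: "h * f \<in> I" if "f \<in> I" for f h
  proof -
    have "poly_word n (h * word_poly (poly_word n f)) \<in> C"
      using cyclic_code_mult[OF assms] that by (simp add: I_def)
    also have "poly_word n (h * word_poly (poly_word n f)) = poly_word n (h * f)"
      using assms(2) by (auto simp: word_poly_poly_word mod_mult_right_eq intro!: poly_word_mod_cong)
    finally show ?thesis by (simp add: I_def)
  qed
  have add: "f + h \<in> I" if "f \<in> I" "h \<in> I" for f h
    using that C(3) by (simp add: I_def poly_word_add)
  have "cyc_modulus n \<in> I \<and> cyc_modulus n \<noteq> (0 :: 'a poly)"
    using zero[OF dvd_refl] degree_cyc_modulus(2)[OF assms(2)] by simp
  from ex_has_least_nat[of "\<lambda>f. f \<in> I \<and> f \<noteq> 0", OF this, of degree]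
  obtain g0 where g0: "g0 \<in> I" "g0 \<noteq> 0"
    and min: "\<And>f. f \<in> I \<Longrightarrow> f \<noteq> 0 \<Longrightarrow> degree g0 \<le> degree f"
    by blast
  define g where "g = smult (inverse (lead_coeff g0)) g0"
  have g: "g \<in> I" using mult[OF g0(1), of "[:inverse (lead_coeff g0):]"] by (simp add: g_def)
  have monic: "lead_coeff g = 1" and deg: "degree g = degree g0" using g0(2) by (auto simp: g_def)
  have dvd: "g dvd f" if "f \<in> I" for f
  proof -
    have eq: "f mod g = f + (- (f div g)) * g" 
      by (simp only: minus_div_mult_eq_mod mult_minus_left add_uminus_conv_diff)
    have "f mod g \<in> I" unfolding eq by (rule add[OF that mult[OF g]])
    moreover have "f mod g = 0 \<or> degree (f mod g) < degree g"
      using degree_mod_less[of g f] g0(2) monic by force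
    ultimately have "f mod g = 0" using min[of "f mod g"] deg by (metis not_le)
    then show ?thesis by (simp add: dvd_eq_mod_eq_0)
  qed
  have "word_poly ` C = {(g * f) mod cyc_modulus n | f. True}"
  proof (intro equalityI subsetI)
    fix p assume "p \<in> word_poly ` C"
    then obtain c where c: "c \<in> C" "p = word_poly c" by auto
    then have cc: "c \<in> carrier_vec n" using C(1) by auto
    then have "word_poly c \<in> I" using c assms(2) by (simp add: I_def poly_word_word_poly)
    then have "g dvd word_poly c" by (rule dvd)
    then obtain f where "word_poly c = g * f" by (elim dvdE)
    then have "p = (g * f) mod cyc_modulus n"
      using word_poly_mod[OF cc assms(2)] c(2) by simp
    then show "p \<in> {(g * f) mod cyc_modulus n | f. True}" by blast
  next
    fix p assume "p \<in> {(g * f) mod cyc_modulus n | f. True}"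
    then obtain f where p: "p = (f * g) mod cyc_modulus n" by (auto simp: mult.commute)
    have "poly_word n (f * g) \<in> C" using mult[OF g] by (simp add: I_def)
    moreover have "p = word_poly (poly_word n (f * g))"
      using assms(2) by (simp add: p word_poly_poly_word)
    ultimately show "p \<in> word_poly ` C" by blast
  qed
  then have "is_generator_poly n C g"
    using monic dvd[OF zero] by (simp add: is_generator_poly_def)
  then show ?thesis ..
qed

lemma cyclic_code_eq_dvd:
  assumes "is_generator_poly n C g" "n > 0" "C \<subseteq> carrier_vec n"
  shows "C = {c \<in> carrier_vec n. g dvd word_poly c}"
proof (intro equalityI subsetI)
  fix c assume c: "c \<in> C"
  then obtain f where "word_poly c = (g * f) mod cyc_modulus n"
    using assms(1) by (auto simp: is_generator_poly_def)
  then have "g dvd word_poly c" using assms(1) by (simp add: is_generator_poly_def dvd_mod)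
  then show "c \<in> {c \<in> carrier_vec n. g dvd word_poly c}" using c assms(3) by auto
next
  fix c assume "c \<in> {c \<in> carrier_vec n. g dvd word_poly c}"
  then have c: "c \<in> carrier_vec n" "g dvd word_poly c" by auto
  from c(2) obtain f where "word_poly c = g * f" by (elim dvdE)
  then have "word_poly c = (g * f) mod cyc_modulus n" using word_poly_mod[OF c(1) assms(2)] by simp
  then have "word_poly c \<in> word_poly ` C" using assms(1) by (auto simp: is_generator_poly_def)
  then show "c \<in> C" using word_poly_inj c(1) assms(3) by (metis carrier_vecD imageE subsetD)
qed

text \<open>As g divides x^n - 1, reduction modulo x^n - 1 does not affect divisibility by g. From
  here on, membership in a cyclic code is divisibility in F[x].\<close>

lemma poly_word_mem_iff:
  assumes "is_generator_poly n C g" "n > 0" "C \<subseteq> carrier_vec n"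
  shows "poly_word n f \<in> C \<longleftrightarrow> g dvd f"
  unfolding cyclic_code_eq_dvd[OF assms]
  using assms by (simp add: word_poly_poly_word is_generator_poly_def dvd_mod_iff)

text \<open>Two generators each represent a word of C, so they divide each other, and both are
  monic. This justifies the \<open>THE\<close> in \<open>generator_poly\<close>.\<close>

lemma generator_poly_eqI:
  assumes "is_generator_poly n C g" "n > 0" "C \<subseteq> carrier_vec n"
  shows "generator_poly n C = g"
  unfolding generator_poly_def
proof (rule the_equality)
  show "is_generator_poly n C g" by (fact assms(1))
next
  fix g' assume g': "is_generator_poly n C g'"
  have "g dvd g'" "g' dvd g"
    using poly_word_mem_iff[OF assms] poly_word_mem_iff[OF g' assms(2,3)] by (metis dvd_refl)+
  moreover have "g \<noteq> 0" using assms(1) by (auto simp: is_generator_poly_def)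
  ultimately show "g' = g"
    using assms(1) g'
    by (intro monic_dvd_degree_eq) (auto simp: is_generator_poly_def intro: dvd_imp_degree_le)
qed

section \<open>The dimension of a cyclic code, by counting its words\<close>

lemma bij_betw_vec_carrier_vec:
  "bij_betw (\<lambda>f. vec k f) ({..<k} \<rightarrow>\<^sub>E (UNIV :: 'a set)) (carrier_vec k)"
proof (rule bij_betw_byWitness[where f' = "\<lambda>v. restrict (($) v) {..<k}"])
  show "\<forall>f\<in>{..<k} \<rightarrow>\<^sub>E UNIV. restrict (($) (vec k f)) {..<k} = f"
    by (auto simp: PiE_def extensional_def restrict_def)
  show "\<forall>v\<in>carrier_vec k. vec k (restrict (($) v) {..<k}) = v"
    by (auto intro!: eq_vecI)
  show "(\<lambda>f. vec k f) ` ({..<k} \<rightarrow>\<^sub>E (UNIV :: 'a set)) \<subseteq> carrier_vec k"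
    by (intro image_subsetI vec_carrier)
  show "(\<lambda>v. restrict (($) v) {..<k}) ` carrier_vec k \<subseteq> {..<k} \<rightarrow>\<^sub>E (UNIV :: 'a set)"
    by (intro image_subsetI) (simp add: PiE_iff)
qed

lemma card_carrier_vec:
  "card (carrier_vec k :: 'a :: finite vec set) = CARD('a) ^ k" "finite (carrier_vec k :: 'a vec set)"
proof -
  note b = bij_betw_vec_carrier_vec[of k, where 'a = 'a]
  show "card (carrier_vec k :: 'a vec set) = CARD('a) ^ k"
    using bij_betw_same_card[OF b] by (simp add: card_PiE)
  show "finite (carrier_vec k :: 'a vec set)"
    using bij_betw_finite[OF b] by (simp add: finite_PiE)
qed

text \<open>Multiplication by g maps the polynomials of degree below n - deg g bijectively onto the
  codewords, with no reduction modulo x^n - 1, so |C| = q^(n - deg g).\<close>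

lemma code_dim_eq:
  fixes C :: "'a :: {field, finite} vec set"
  assumes "is_generator_poly n C g" "n > 0" "linear_code n C"
  shows "code_dim n C = n - degree g"
proof -
  have sub: "C \<subseteq> carrier_vec n" using linear_codeD(1)[OF assms(3)] .
  have fin: "finite C" using sub card_carrier_vec(2) finite_subset by blast
  have g: "lead_coeff g = 1" "g dvd cyc_modulus n" "g \<noteq> 0"
    using assms(1) by (auto simp: is_generator_poly_def)
  have dg: "degree g \<le> n"
    using dvd_imp_degree_le[OF g(2)] degree_cyc_modulus[OF assms(2), where 'a = 'a] by simp
  let ?k = "n - degree g"
  \<comment> \<open>The zero polynomial has degree 0, which is not below \<open>?k\<close> when
    \<open>?k = 0\<close>, so it is kept as a separate case.\<close>
  have wd: "word_poly c = 0 \<or> degree (word_poly c) < ?k" if "c \<in> carrier_vec ?k" for c :: "'a vec"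
  proof (cases "?k = 0")
    case True
    then show ?thesis using that by (auto simp: word_poly_def)
  qed (use that degree_word_poly_less[of c] in auto)
  have low: "poly_word n p \<in> C \<and> word_poly (poly_word n p) = p"
    if "p = g * word_poly c" "c \<in> carrier_vec ?k" for p c
  proof -
    have "p = 0 \<or> degree p < n"
      using wd[OF that(2)] that(1) g(3) by (cases "word_poly c = 0") (auto simp: degree_mult_eq)
    then have "p mod cyc_modulus n = p"
      using degree_cyc_modulus(1)[OF assms(2), where 'a = 'a] by (auto simp: mod_poly_less)
    then show ?thesis
      using that poly_word_mem_iff[OF assms(1,2) sub] assms(2) by (simp add: word_poly_poly_word)
  qed
  have "bij_betw (\<lambda>c. poly_word n (g * word_poly c)) (carrier_vec ?k) C"
  proof (rule bij_betwI')
    fix c d :: "'a vec" assume cd: "c \<in> carrier_vec ?k" "d \<in> carrier_vec ?k"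
    show "poly_word n (g * word_poly c) = poly_word n (g * word_poly d) \<longleftrightarrow> c = d"
      using low[OF refl cd(1)] low[OF refl cd(2)] cd g(3) word_poly_inj[of c d]
      by (metis carrier_vecD mult_cancel_left)
  next
    fix c assume "c \<in> C"
    then have c: "c \<in> carrier_vec n" "g dvd word_poly c" using cyclic_code_eq_dvd[OF assms(1,2) sub] by auto
    then obtain f where f: "word_poly c = g * f" by (elim dvdE)
    have df: "f = 0 \<or> degree f < ?k"
      using degree_word_poly_less[of c] c(1) assms(2) f g(3)
      by (cases "f = 0") (auto simp: degree_mult_eq)
    have "word_poly (vec ?k (coeff f)) = f"
      using df by (intro poly_eqI) (auto simp: coeff_word_poly coeff_eq_0)
    then show "\<exists>d\<in>carrier_vec ?k. c = poly_word n (g * word_poly d)"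
      using f poly_word_word_poly[OF c(1) assms(2)] by (intro bexI[of _ "vec ?k (coeff f)"]) auto
  qed (use low[OF refl] in simp)
  then have "card C = CARD('a) ^ ?k"
    using bij_betw_same_card card_carrier_vec(1) by metis
  then show ?thesis
    using card_linear_code[OF assms(3) fin] card_field_gt_1[where 'a = 'a] by simp
qed

section \<open>Zeros of cyclic codes\<close>

text \<open>\<open>of_nat_n\<close> says that the characteristic does not divide n; this is what
  inverting the transform over the powers of alpha requires.\<close>

locale root_of_unity_embedding = field_hom emb
  for emb :: "'a :: {field, finite} \<Rightarrow> 'b :: field" +
  fixes \<alpha> :: 'b and n :: nat
  assumes n_pos: "n > 0"
    and primitive: "primitive_root_of_unity n \<alpha>"
    and of_nat_n: "of_nat n \<noteq> (0 :: 'b)"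
begin

interpretation map_poly_hom: map_poly_comm_ring_hom emb ..

text \<open>As s varies this is the discrete Fourier transform of f. Exponents are arbitrary
  integers, so that negation and multiplication by q need no reduction.\<close>

definition eval_root :: "'a poly \<Rightarrow> int \<Rightarrow> 'b" where
  "eval_root f s = poly (map_poly emb f) (\<alpha> powi s)"

definition zero_set :: "'a poly \<Rightarrow> int set" where
  "zero_set g = {s \<in> {0..<int n}. eval_root g s = 0}"

section \<open>Powers of the root of unity\<close>

lemma alpha_nz [simp]: "\<alpha> \<noteq> 0"
proof
  assume "\<alpha> = 0"
  then have "\<alpha> ^ n = 0" using n_pos by simp
  then show False using primitive unfolding primitive_root_of_unity_def by simp
qed

lemma alpha_powi_mod: "\<alpha> powi (s mod int n) = \<alpha> powi s"
proof -
  have "\<alpha> powi s = \<alpha> powi (int n * (s div int n) + s mod int n)" by simp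
  also have "\<dots> = (\<alpha> powi int n) powi (s div int n) * \<alpha> powi (s mod int n)"
    by (simp only: power_int_add[OF disjI1[OF alpha_nz]] power_int_mult)
  also have "\<alpha> powi int n = 1"
    using primitive by (simp add: primitive_root_of_unity_def)
  finally show ?thesis by simp
qed

lemma alpha_powi_eq_1_iff: "\<alpha> powi s = 1 \<longleftrightarrow> int n dvd s"
proof
  assume "\<alpha> powi s = 1"
  then have 1: "\<alpha> powi (s mod int n) = 1" by (simp only: alpha_powi_mod)
  obtain r where r: "s mod int n = int r"
    using n_pos by (metis nonneg_int_cases pos_mod_sign of_nat_0_less_iff)
  then have "r < n" using n_pos by (metis of_nat_0_less_iff of_nat_less_iff pos_mod_bound)
  moreover have "\<alpha> ^ r = 1" using 1 unfolding r by simp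
  ultimately have "r = 0" using primitive by (auto simp: primitive_root_of_unity_def)
  then show "int n dvd s" using r by (simp add: dvd_eq_mod_eq_0)
next
  assume "int n dvd s"
  then show "\<alpha> powi s = 1" using alpha_powi_mod[of s] by simp
qed

lemma alpha_powi_eq_iff: "\<alpha> powi s = \<alpha> powi t \<longleftrightarrow> s mod int n = t mod int n"
proof -
  have "\<alpha> powi s = \<alpha> powi t \<longleftrightarrow> \<alpha> powi (s - t) = 1"
    by (simp add: power_int_diff)
  then show ?thesis by (simp add: alpha_powi_eq_1_iff mod_eq_dvd_iff)
qed

lemma inj_on_alpha_powi: "inj_on ((powi) \<alpha>) {0..<int n}"
  by (rule inj_onI) (simp add: alpha_powi_eq_iff)

text \<open>Orthogonality of characters: a geometric series whose ratio alpha^a is an n-th root of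
  unity, equal to 1 exactly when n divides a.\<close>

lemma sum_alpha_powi: "(\<Sum>j<n. \<alpha> powi (int j * a)) = (if int n dvd a then of_nat n else 0)"
proof (cases "int n dvd a")
  case True
  then have "\<alpha> powi (int j * a) = 1" for j by (simp only: alpha_powi_eq_1_iff dvd_mult)
  then show ?thesis using True by simp
next
  case False
  let ?x = "\<alpha> powi a"
  have "?x ^ n = \<alpha> powi (a * int n)" by (simp add: power_int_mult)
  also have "\<dots> = 1" by (simp add: alpha_powi_eq_1_iff)
  finally have "?x ^ n = 1" .
  moreover have "?x \<noteq> 1" using False alpha_powi_eq_1_iff by simp
  moreover have "\<alpha> powi (int j * a) = ?x ^ j" for j
    by (simp add: power_int_mult[symmetric] mult.commute flip: power_int_of_nat)
  ultimately show ?thesis using False by (simp add: geometric_sum)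
qed

section \<open>Evaluation at the powers of the root of unity, and zero sets\<close>

lemma eval_root_add: "eval_root (f + g) s = eval_root f s + eval_root g s"
  by (simp add: eval_root_def hom_distribs)

lemma eval_root_mult: "eval_root (f * g) s = eval_root f s * eval_root g s"
  by (simp add: eval_root_def map_poly_hom.hom_mult)

lemma eval_root_0 [simp]: "eval_root 0 s = 0"
  by (simp add: eval_root_def)

lemma eval_root_monom: "eval_root (monom a k) s = emb a * \<alpha> powi (s * int k)"
  by (simp add: eval_root_def poly_monom power_int_mult)

lemma eval_root_pCons: "eval_root (pCons a f) s = emb a + \<alpha> powi s * eval_root f s"
proof -
  have "pCons a f = monom a 0 + monom 1 1 * f" by (simp add: monom_altdef)
  then show ?thesis by (simp only: eval_root_add eval_root_mult eval_root_monom) simp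
qed

lemma eval_root_sum: "eval_root (\<Sum>k\<in>A. f k) s = (\<Sum>k\<in>A. eval_root (f k) s)"
  by (induction A rule: infinite_finite_induct) (auto simp: eval_root_add)

lemma eval_root_cong: "s mod int n = t mod int n \<Longrightarrow> eval_root f s = eval_root f t"
  using alpha_powi_eq_iff[of s t] by (simp add: eval_root_def)

lemma map_poly_cyc_modulus: "map_poly emb (cyc_modulus n) = cyc_modulus n"
  by (rule poly_eqI) (simp add: hom_distribs)

lemma eval_root_cyc_modulus [simp]: "eval_root (cyc_modulus n) s = 0"
proof -
  have "(\<alpha> powi s) ^ n = \<alpha> powi (s * int n)" by (simp add: power_int_mult)
  also have "\<dots> = 1" by (simp add: alpha_powi_eq_1_iff)
  finally show ?thesis by (simp add: eval_root_def map_poly_cyc_modulus poly_monom)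
qed

lemma eval_root_mod [simp]: "eval_root (f mod cyc_modulus n) s = eval_root f s"
proof -
  have "eval_root (f div cyc_modulus n * cyc_modulus n) s = 0"
    unfolding eval_root_mult eval_root_cyc_modulus by (rule mult_zero_right)
  moreover have "eval_root (f div cyc_modulus n * cyc_modulus n) s + eval_root (f mod cyc_modulus n) s =
      eval_root f s"
    unfolding eval_root_add[symmetric] div_mult_mod_eq ..
  ultimately show ?thesis by (simp only: add_0)
qed

lemma cyc_modulus_eq_prod:
  "cyc_modulus n = (\<Prod>r\<in>(powi) \<alpha> ` {0..<int n}. [:- r, 1:])"
proof (rule monic_dvd_degree_eq)
  show "(\<Prod>r\<in>(powi) \<alpha> ` {0..<int n}. [:- r, 1:]) dvd cyc_modulus n"
  proof (rule prod_linear_dvd)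
    fix r assume "r \<in> (powi) \<alpha> ` {0..<int n}"
    then obtain s where "r = \<alpha> powi s" by auto
    then show "poly (cyc_modulus n) r = 0"
      using eval_root_cyc_modulus[of s] by (simp add: eval_root_def map_poly_cyc_modulus)
  qed simp
  show "degree (cyc_modulus n :: 'b poly) \<le> degree (\<Prod>r\<in>(powi) \<alpha> ` {0..<int n}. [:- r, 1:])"
    using degree_cyc_modulus(1)[OF n_pos, where 'a = 'b] card_image[OF inj_on_alpha_powi] by simp
qed (use lead_coeff_cyc_modulus[OF n_pos] in simp_all)

lemma map_poly_eq_prod_zero_set:
  assumes "lead_coeff g = 1" "g dvd cyc_modulus n"
  shows "map_poly emb g = (\<Prod>s\<in>zero_set g. [:- (\<alpha> powi s), 1:])"
proof -
  let ?R = "(powi) \<alpha> ` {0..<int n}"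
  obtain k where k: "cyc_modulus n = g * k" using assms(2) by (elim dvdE)
  have "map_poly emb g dvd cyc_modulus n"
    unfolding map_poly_cyc_modulus[symmetric] k by (simp add: map_poly_hom.hom_mult)
  moreover have "lead_coeff (map_poly emb g) = 1"
    using assms(1) by simp
  ultimately have "map_poly emb g = (\<Prod>r\<in>{r \<in> ?R. poly (map_poly emb g) r = 0}. [:- r, 1:])"
    by (intro monic_dvd_prod_linear) (auto simp: cyc_modulus_eq_prod)
  also have "{r \<in> ?R. poly (map_poly emb g) r = 0} = (powi) \<alpha> ` zero_set g"
    by (auto simp: zero_set_def eval_root_def)
  also have "(\<Prod>r\<in>\<dots>. [:- r, 1:]) = (\<Prod>s\<in>zero_set g. [:- (\<alpha> powi s), 1:])"
    by (subst prod.reindex) (auto intro: inj_on_subset[OF inj_on_alpha_powi] simp: zero_set_def)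
  finally show ?thesis .
qed

lemma degree_eq_card_zero_set:
  assumes "lead_coeff g = 1" "g dvd cyc_modulus n"
  shows "degree g = card (zero_set g)"
proof -
  have "degree g = degree (map_poly emb g)"
    by simp
  also have "\<dots> = card (zero_set g)"
    unfolding map_poly_eq_prod_zero_set[OF assms]
    by (subst degree_prod_eq_sum_degree) auto
  finally show ?thesis .
qed

lemma finite_zero_set [simp]: "finite (zero_set g)"
  by (rule finite_subset[of _ "{0..<int n}"]) (auto simp: zero_set_def)

text \<open>This is squarefreeness of x^n - 1, obtained by counting: the zero sets of g and h cover
  all n residues and their sizes add up to n, so they are disjoint.\<close>

lemma cofactor_nonzero:
  assumes "cyc_modulus n = g * h" "eval_root g s = 0" "lead_coeff g = 1" "lead_coeff h = 1"
  shows "eval_root h s \<noteq> 0"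
proof
  assume h: "eval_root h s = 0"
  have s: "s mod int n \<in> zero_set g \<inter> zero_set h"
    using assms(2) h n_pos eval_root_cong[of "s mod int n" s] by (simp add: zero_set_def)
  have "zero_set g \<union> zero_set h = {0..<int n}"
    using eval_root_cyc_modulus unfolding assms(1) by (auto simp: zero_set_def eval_root_mult)
  then have "n = card (zero_set g \<union> zero_set h)" by simp
  moreover have "card (zero_set g \<inter> zero_set h) > 0" using s by (auto simp: card_gt_0_iff)
  moreover have "degree g + degree h = n"
  proof -
    have "g \<noteq> 0" "h \<noteq> 0" using assms(3,4) by auto
    then have "degree (g * h) = degree g + degree h" by (rule degree_mult_eq)
    then show ?thesis using degree_cyc_modulus(1)[OF n_pos, where 'a = 'a] unfolding assms(1) by simp
  qed
  moreover have "degree g = card (zero_set g)"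
    by (rule degree_eq_card_zero_set[OF assms(3)]) (simp add: assms(1))
  moreover have "degree h = card (zero_set h)"
    by (rule degree_eq_card_zero_set[OF assms(4)]) (simp add: assms(1))
  ultimately show False
    using card_Un_Int[of "zero_set g" "zero_set h"] by simp
qed

lemma frobenius_add: "(x + y) ^ CARD('a) = x ^ CARD('a) + y ^ CARD('a)" for x y :: 'b
proof -
  let ?q = "CARD('a)"
  have q: "?q > 0" by simp
  have split: "{..?q} = insert 0 (insert ?q {0<..<?q})" using q by auto
  have "of_nat (?q choose k) = (0 :: 'b)" if "k \<in> {0<..<?q}" for k
  proof -
    have "emb (of_nat (?q choose k)) = emb 0"
      using that of_nat_card_choose_eq_0[of k, where 'a = 'a] by simp
    then show ?thesis by (simp add: hom_of_nat)
  qed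
  then have "(\<Sum>k\<in>{0<..<?q}. of_nat (?q choose k) * x ^ k * y ^ (?q - k)) = 0"
    by (intro sum.neutral) simp
  then show ?thesis unfolding binomial_ring split by (simp add: add.commute)
qed

text \<open>The coefficients of f lie in F_q and are fixed by q-th powers, hence f(x^q) = f(x)^q.
  This is why zero sets are unions of cyclotomic cosets.\<close>

lemma eval_root_frobenius: "eval_root f (s * int CARD('a)) = eval_root f s ^ CARD('a)"
proof (induction f)
  case (pCons a f)
  have "emb a ^ CARD('a) = emb a" by (simp add: power_card_field flip: hom_power)
  then show ?case
    by (simp add: eval_root_pCons frobenius_add pCons.IH power_mult_distrib power_int_mult)
qed (simp add: power_0_left)

lemma zero_set_mult_card:
  assumes "s \<in> zero_set g"
  shows "(s * int CARD('a)) mod int n \<in> zero_set g"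
proof -
  have "eval_root g ((s * int CARD('a)) mod int n) = eval_root g (s * int CARD('a))"
    by (rule eval_root_cong) simp
  then show ?thesis using assms n_pos by (simp add: zero_set_def eval_root_frobenius power_0_left)
qed

section \<open>Duality\<close>

lemma eval_root_word_poly:
  "c \<in> carrier_vec n \<Longrightarrow> eval_root (word_poly c) s = (\<Sum>k<n. emb (c $ k) * \<alpha> powi (s * int k))"
  by (simp add: word_poly_def eval_root_sum eval_root_monom)

lemma eval_root_poly_word [simp]: "eval_root (word_poly (poly_word n f)) s = eval_root f s"
  by (simp add: word_poly_poly_word n_pos)

text \<open>After expansion, summing over j first leaves only the diagonal k = l. Evaluating d at
  negated exponents takes the place of complex conjugation.\<close>

lemma parseval:
  assumes "c \<in> carrier_vec n" "d \<in> carrier_vec n"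
  shows "(\<Sum>j<n. eval_root (word_poly c) (int j) * eval_root (word_poly d) (- int j)) =
    of_nat n * emb (d \<bullet> c)"
proof -
  have "(\<Sum>j<n. eval_root (word_poly c) (int j) * eval_root (word_poly d) (- int j)) =
      (\<Sum>j<n. \<Sum>k<n. \<Sum>l<n. emb (c $ k) * emb (d $ l) * \<alpha> powi (int j * (int k - int l)))"
    unfolding eval_root_word_poly[OF assms(1)] eval_root_word_poly[OF assms(2)] sum_product
    by (intro sum.cong refl) (simp add: algebra_simps power_int_diff power_int_minus divide_inverse)
  also have "\<dots> = (\<Sum>k<n. \<Sum>l<n. emb (c $ k) * emb (d $ l) * (\<Sum>j<n. \<alpha> powi (int j * (int k - int l))))"
    unfolding sum_distrib_left
    by (subst sum.swap, rule sum.cong[OF refl], subst sum.swap, rule refl)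
  also have "\<dots> = (\<Sum>k<n. \<Sum>l<n. if k = l then emb (c $ k) * emb (d $ l) * of_nat n else 0)"
  proof (intro sum.cong refl)
    fix k l assume "k \<in> {..<n}" "l \<in> {..<n}"
    then have "int n dvd int k - int l \<longleftrightarrow> k = l"
      by (simp flip: mod_eq_dvd_iff)
    then show "emb (c $ k) * emb (d $ l) * (\<Sum>j<n. \<alpha> powi (int j * (int k - int l))) =
        (if k = l then emb (c $ k) * emb (d $ l) * of_nat n else 0)"
      by (simp add: sum_alpha_powi)
  qed
  also have "\<dots> = of_nat n * (\<Sum>k<n. emb (d $ k) * emb (c $ k))"
    by (simp add: sum_distrib_left algebra_simps)
  also have "(\<Sum>k<n. emb (d $ k) * emb (c $ k)) = emb (d \<bullet> c)"
    using assms(1) by (simp add: scalar_prod_def hom_distribs lessThan_atLeast0)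
  finally show ?thesis .
qed

text \<open>Multiplying the l-th equation by alpha^(-rl) and summing over l isolates n times w r,
  and n is invertible in \<open>'b\<close>.\<close>

lemma inverse_transform:
  assumes "\<And>l. l < n \<Longrightarrow> (\<Sum>j<n. w j * \<alpha> powi (int j * int l)) = 0" "r < n"
  shows "w r = 0"
proof -
  have "0 = (\<Sum>l<n. \<alpha> powi (- (int r * int l)) * (\<Sum>j<n. w j * \<alpha> powi (int j * int l)))"
    using assms(1) by simp
  also have "\<dots> = (\<Sum>l<n. \<Sum>j<n. w j * \<alpha> powi (int l * (int j - int r)))"
    unfolding sum_distrib_left
    by (intro sum.cong refl)
      (simp add: algebra_simps power_int_diff power_int_minus divide_inverse)
  also have "\<dots> = (\<Sum>j<n. w j * (\<Sum>l<n. \<alpha> powi (int l * (int j - int r))))"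
    unfolding sum_distrib_left by (rule sum.swap)
  also have "\<dots> = (\<Sum>j<n. if j = r then w j * of_nat n else 0)"
  proof (intro sum.cong refl)
    fix j assume "j \<in> {..<n}"
    then have "int n dvd int j - int r \<longleftrightarrow> j = r"
      using assms(2) by (simp flip: mod_eq_dvd_iff)
    then show "w j * (\<Sum>l<n. \<alpha> powi (int l * (int j - int r))) = (if j = r then w j * of_nat n else 0)"
      by (simp add: sum_alpha_powi)
  qed
  also have "\<dots> = w r * of_nat n" using assms(2) by simp
  finally show ?thesis using of_nat_n by simp
qed

text \<open>Orthogonality to a single word only makes a sum of products vanish; orthogonality to all
  its cyclic shifts makes each product vanish.\<close>

lemma dual_code_iff:
  assumes "cyclic_code n C" "d \<in> carrier_vec n"
  shows "d \<in> dual_code n C \<longleftrightarrow>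
    (\<forall>c\<in>C. \<forall>s. eval_root (word_poly c) s * eval_root (word_poly d) (- s) = 0)"
proof
  have C: "C \<subseteq> carrier_vec n" using assms(1) linear_codeD(1) by (auto simp: cyclic_code_def)
  {
    assume d: "d \<in> dual_code n C"
    show "\<forall>c\<in>C. \<forall>s. eval_root (word_poly c) s * eval_root (word_poly d) (- s) = 0"
    proof (intro ballI allI)
      fix c s assume c: "c \<in> C"
      define w where "w j = eval_root (word_poly c) (int j) * eval_root (word_poly d) (- int j)" for j
      have "w r = 0" if "r < n" for r
      proof (rule inverse_transform[OF _ that])
        fix l
        \<comment> \<open>Multiplying c by x^l multiplies its j-th transform value by alpha^(jl), so
          orthogonality to this word says that the l-th coefficient of the transform of
          \<open>w\<close> is zero.\<close>
        let ?c = "poly_word n (monom 1 l * word_poly c)"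
        have "d \<bullet> ?c = 0"
          using d cyclic_code_mult[OF assms(1) n_pos c] by (simp add: vec_module.orthogonal_complement_def)
        then have "0 = (\<Sum>j<n. eval_root (word_poly ?c) (int j) * eval_root (word_poly d) (- int j))"
          using parseval[of ?c d] assms(2) by simp
        also have "\<dots> = (\<Sum>j<n. w j * \<alpha> powi (int j * int l))"
          by (simp add: w_def eval_root_mult eval_root_monom mult_ac)
        finally show "(\<Sum>j<n. w j * \<alpha> powi (int j * int l)) = 0" ..
      qed
      moreover have r: "nat (s mod int n) < n" "int (nat (s mod int n)) = s mod int n"
        using n_pos by (simp_all add: nat_less_iff)
      ultimately have "w (nat (s mod int n)) = 0" by simp
      moreover have "eval_root (word_poly c) (s mod int n) = eval_root (word_poly c) s"
        "eval_root (word_poly d) (- (s mod int n)) = eval_root (word_poly d) (- s)"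
        by (rule eval_root_cong; simp add: mod_minus_eq)+
      ultimately show "eval_root (word_poly c) s * eval_root (word_poly d) (- s) = 0"
        unfolding w_def r(2) by simp
    qed
  next
    assume zero: "\<forall>c\<in>C. \<forall>s. eval_root (word_poly c) s * eval_root (word_poly d) (- s) = 0"
    have "d \<bullet> c = 0" if "c \<in> C" for c
      using parseval[of c d] zero that C assms(2) of_nat_n by auto
    then show "d \<in> dual_code n C"
      using assms(2) by (simp add: vec_module.orthogonal_complement_def)
  }
qed

text \<open>A shift multiplies each transform value by a power of alpha, so the criterion of
  \<open>dual_code_iff\<close> is preserved.\<close>

lemma dual_code_cyclic:
  fixes C :: "'a vec set"
  assumes "cyclic_code n C"
  shows "cyclic_code n (dual_code n C)"
proof -
  have C: "C \<subseteq> carrier_vec n" using assms linear_codeD(1) by (auto simp: cyclic_code_def)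
  have sub: "dual_code n C \<subseteq> carrier_vec n" by (auto simp: vec_module.orthogonal_complement_def)
  have "linear_code n (dual_code n C)"
    using C by (intro linear_codeI)
      (auto simp: vec_module.orthogonal_complement_def add_scalar_prod_distrib[where n = n] subset_iff)
  moreover have "cyclic_shift n c \<in> dual_code n C" if c: "c \<in> dual_code n C" for c
  proof -
    have "c \<in> carrier_vec n" using c sub by auto
    then show ?thesis
      using c by (auto simp: dual_code_iff[OF assms] cyclic_shift_eq n_pos eval_root_mult)
  qed
  ultimately show ?thesis by (simp add: cyclic_code_def)
qed

text \<open>If g does not vanish at -s, pairing the words of g and g' in
  \<open>dual_code_iff\<close> forces g' to vanish at s. If g vanishes at -s, a dual word built from
  the check polynomial h = (x^n - 1)/g does not vanish at s, hence neither does g'.\<close>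

lemma zero_set_dual:
  assumes "cyclic_code n C" "is_generator_poly n C g" "is_generator_poly n (dual_code n C) g'"
  shows "zero_set g' = {s \<in> {0..<int n}. eval_root g (- s) \<noteq> 0}"
proof -
  have C: "C \<subseteq> carrier_vec n" using assms(1) linear_codeD(1) by (auto simp: cyclic_code_def)
  have D: "dual_code n C \<subseteq> carrier_vec n" by (auto simp: vec_module.orthogonal_complement_def)
  have g: "lead_coeff g = 1" "g dvd cyc_modulus n" using assms(2) by (auto simp: is_generator_poly_def)
  then obtain h where h: "cyc_modulus n = g * h" by (elim dvdE)
  have h1: "lead_coeff h = 1"
    using lead_coeff_mult[of g h] lead_coeff_cyc_modulus[OF n_pos, where 'a = 'a] g(1)
    unfolding h by simp
  have "eval_root g' s = 0 \<longleftrightarrow> eval_root g (- s) \<noteq> 0" for s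
  proof
    assume g's: "eval_root g' s = 0"
    show "eval_root g (- s) \<noteq> 0"
    proof
      assume gs: "eval_root g (- s) = 0"
      \<comment> \<open>On n-th roots of unity x^(n-1) is the inverse of x, so f has the transform
        of h with negated exponents: it acts as the reversed check polynomial.\<close>
      define f where "f = pcompose h (monom 1 (n - 1))"
      have f: "eval_root f r = eval_root h (- r)" for r
      proof -
        have "eval_root f r = eval_root h (r * int (n - 1))"
          by (simp add: f_def eval_root_def hom_distribs poly_pcompose poly_monom power_int_mult)
        also have "\<dots> = eval_root h (- r)"
          using n_pos by (intro eval_root_cong) (simp add: of_nat_diff mod_eq_dvd_iff algebra_simps)
        finally show ?thesis .
      qed
      have "poly_word n f \<in> dual_code n C"
        unfolding dual_code_iff[OF assms(1) poly_word_carrier]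
      proof (intro ballI allI)
        fix c r assume "c \<in> C"
        then have "g dvd word_poly c" using cyclic_code_eq_dvd[OF assms(2) n_pos C] by auto
        then obtain k where k: "word_poly c = g * k" by (elim dvdE)
        have "eval_root g r * eval_root h r = 0"
          using eval_root_cyc_modulus[of r] unfolding h eval_root_mult .
        then show "eval_root (word_poly c) r * eval_root (word_poly (poly_word n f)) (- r) = 0"
          unfolding k by (auto simp: eval_root_mult f)
      qed
      then have "g' dvd f" using poly_word_mem_iff[OF assms(3) n_pos D] by simp
      then obtain k where "f = g' * k" by (elim dvdE)
      then have "eval_root f s = 0" using g's by (simp add: eval_root_mult)
      then show False using cofactor_nonzero[OF h gs g(1) h1] by (simp add: f)
    qed
  next
    assume gs: "eval_root g (- s) \<noteq> 0"
    have "poly_word n g \<in> C" using poly_word_mem_iff[OF assms(2) n_pos C] by simp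
    moreover have "poly_word n g' \<in> dual_code n C" using poly_word_mem_iff[OF assms(3) n_pos D] by simp
    ultimately have "eval_root g (- s) * eval_root g' s = 0"
      using dual_code_iff[OF assms(1) poly_word_carrier] by (metis eval_root_poly_word minus_minus)
    then show "eval_root g' s = 0" using gs by simp
  qed
  then show ?thesis by (simp add: zero_set_def)
qed

lemma code_hull_cyclic:
  fixes C :: "'a vec set"
  assumes "cyclic_code n C"
  shows "cyclic_code n (code_hull n C)"
  using assms dual_code_cyclic[OF assms] linear_code_Int
  unfolding cyclic_code_def code_hull_def by blast

text \<open>The generator of an intersection is the least common multiple. For the zeros it suffices
  that g and g' divide gH and that gH divides their product.\<close>

lemma zero_set_hull:
  assumes "cyclic_code n C" "is_generator_poly n C g" "is_generator_poly n (dual_code n C) g'"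
    and gH: "is_generator_poly n (code_hull n C) gH"
  shows "zero_set gH = zero_set g \<union> zero_set g'"
proof -
  have C: "C \<subseteq> carrier_vec n"
    using assms(1) linear_codeD(1) by (auto simp: cyclic_code_def)
  have D: "dual_code n C \<subseteq> carrier_vec n" by (auto simp: vec_module.orthogonal_complement_def)
  have H: "code_hull n C \<subseteq> carrier_vec n" using C by (auto simp: code_hull_def)
  have mem: "poly_word n f \<in> code_hull n C \<longleftrightarrow> g dvd f \<and> g' dvd f" for f
    using poly_word_mem_iff[OF assms(2) n_pos C] poly_word_mem_iff[OF assms(3) n_pos D]
    by (simp add: code_hull_def)
  note memH = poly_word_mem_iff[OF gH n_pos H]
  have "eval_root gH s = 0 \<longleftrightarrow> eval_root g s = 0 \<or> eval_root g' s = 0" for s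
  proof
    have "gH dvd g * g'" unfolding memH[symmetric] mem by simp
    then obtain k where "g * g' = gH * k" by (elim dvdE)
    then have "eval_root g s * eval_root g' s = eval_root gH s * eval_root k s"
      by (simp flip: eval_root_mult)
    then show "eval_root g s = 0 \<or> eval_root g' s = 0" if "eval_root gH s = 0" using that by simp
  next
    have "g dvd gH \<and> g' dvd gH" unfolding mem[symmetric] memH by simp
    moreover have "eval_root gH s = 0" if "p dvd gH" "eval_root p s = 0" for p
      using that by (auto simp: eval_root_mult)
    ultimately show "eval_root gH s = 0" if "eval_root g s = 0 \<or> eval_root g' s = 0"
      using that by blast
  qed
  then show ?thesis by (auto simp: zero_set_def)
qed

lemma hull_dim_eq:
  assumes "cyclic_code n C" "is_generator_poly n (dual_code n C) g'"
  shows "hull_dim n C = card {s \<in> zero_set g'. (- s) mod int n \<notin> zero_set g'}"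
proof -
  let ?neg = "\<lambda>s. (- s) mod int n"
  let ?A = "{s \<in> zero_set g'. ?neg s \<notin> zero_set g'}"
  obtain g where g: "is_generator_poly n C g"
    using generator_poly_exists[OF assms(1) n_pos] by auto
  obtain gH where gH: "is_generator_poly n (code_hull n C) gH"
    using generator_poly_exists[OF code_hull_cyclic[OF assms(1)] n_pos] by auto
  have lin: "linear_code n (code_hull n C)"
    using code_hull_cyclic[OF assms(1)] by (simp add: cyclic_code_def)
  have g': "s \<in> zero_set g' \<longleftrightarrow> ?neg s \<notin> zero_set g" if "s \<in> {0..<int n}" for s
    using that n_pos eval_root_cong[of "?neg s" "- s" g]
    unfolding zero_set_dual[OF assms(1) g assms(2)] by (auto simp: zero_set_def)
  have neg: "?neg s \<in> {0..<int n}" "s \<in> {0..<int n} \<Longrightarrow> ?neg (?neg s) = s" for s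
    using n_pos by (simp_all add: mod_minus_eq)
  have sub: "zero_set f \<subseteq> {0..<int n}" for f by (auto simp: zero_set_def)
  have "degree gH = card (zero_set gH)"
    using gH unfolding is_generator_poly_def by (intro degree_eq_card_zero_set) blast+
  then have "hull_dim n C = n - card (zero_set g \<union> zero_set g')"
    unfolding hull_dim_def code_dim_eq[OF gH n_pos lin] zero_set_hull[OF assms(1) g assms(2) gH]
    by simp
  also have "\<dots> = card ({0..<int n} - (zero_set g \<union> zero_set g'))"
    using sub by (subst card_Diff_subset) simp_all
  \<comment> \<open>A residue s lies outside the zeros of g iff -s is a zero of g'. So the residues
    outside both zero sets are the negatives of the elements of \<open>?A\<close>.\<close>
  also have "{0..<int n} - (zero_set g \<union> zero_set g') = ?neg ` ?A"
  proof (intro equalityI subsetI)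
    fix s assume s: "s \<in> {0..<int n} - (zero_set g \<union> zero_set g')"
    then have "?neg s \<in> ?A" using g'[of "?neg s"] neg[of s] by auto
    moreover have "s = ?neg (?neg s)" using s neg(2) by simp
    ultimately show "s \<in> ?neg ` ?A" by blast
  next
    fix s assume "s \<in> ?neg ` ?A"
    then obtain r where r: "r \<in> zero_set g'" "?neg r \<notin> zero_set g'" "s = ?neg r" by blast
    moreover have "r \<in> {0..<int n}" using r(1) sub by blast
    ultimately show "s \<in> {0..<int n} - (zero_set g \<union> zero_set g')"
      using g'[of r] neg(1)[of r] by blast
  qed
  also have "card (?neg ` ?A) = card ?A"
    using neg(2) sub by (intro card_image inj_onI) (metis (no_types, lifting) mem_Collect_eq subsetD)
  finally show ?thesis .
qed

end

section \<open>Cyclotomic cosets\<close>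

text \<open>\<open>order\<close> makes q invertible modulo n, so every orbit under multiplication by
  q is periodic and the \<open>LEAST\<close> in \<open>coset_size\<close> is attained.\<close>

locale cyclotomic_cosets =
  fixes q n m :: nat
  assumes n_gt_0: "n > 0" and m_gt_0: "m > 0"
    and order: "[int q ^ m = 1] (mod int n)"
begin

abbreviation B :: "int \<Rightarrow> int set" where "B \<equiv> cyc_coset q n"

abbreviation neg :: "int \<Rightarrow> int" where "neg s \<equiv> (- s) mod int n"

text \<open>Removes the period from the description: reducing k modulo the coset size leaves a q^k
  unchanged modulo n. Later arguments see only the full orbit.\<close>

lemma mem_coset_iff: "b \<in> B a \<longleftrightarrow> (\<exists>k. b = (a * int q ^ k) mod int n)"
proof
  assume "\<exists>k. b = (a * int q ^ k) mod int n"
  then obtain k where k: "b = (a * int q ^ k) mod int n" ..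
  define d where "d = coset_size q n a"
  have "[a * int q ^ m = a * 1] (mod int n)"
    using order by (rule cong_scalar_left)
  then have "m > 0 \<and> [a * int q ^ m = a] (mod int n)" using m_gt_0 by simp
  from LeastI[of "\<lambda>d. d > 0 \<and> [a * int q ^ d = a] (mod int n)", OF this]
  have d: "d > 0" "[a * int q ^ d = a] (mod int n)"
    unfolding d_def coset_size_def by blast+
  have period: "[a * int q ^ (d * e) = a] (mod int n)" for e
  proof (induction e)
    case (Suc e)
    have "[a * int q ^ (d * e) * int q ^ d = a * int q ^ d] (mod int n)"
      using Suc by (rule cong_scalar_right)
    then have "[a * int q ^ (d * Suc e) = a * int q ^ d] (mod int n)"
      by (simp add: power_add mult_ac)
    then show ?case using d(2) by (rule cong_trans)
  qed simp
  have "[a * int q ^ (d * (k div d)) * int q ^ (k mod d) = a * int q ^ (k mod d)] (mod int n)"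
    by (rule cong_scalar_right[OF period])
  then have "[a * int q ^ k = a * int q ^ (k mod d)] (mod int n)"
    by (simp only: mult.assoc power_add[symmetric] mult_div_mod_eq)
  then have "b = (a * int q ^ (k mod d)) mod int n" by (simp add: k cong_def)
  then show "b \<in> B a" using d(1) by (simp add: cyc_coset_def flip: d_def)
qed (auto simp: cyc_coset_def)

lemma coset_subset: "B a \<subseteq> {0..<int n}"
  using n_gt_0 by (auto simp: mem_coset_iff)

lemma finite_coset [simp]: "finite (B a)"
  by (simp add: cyc_coset_def)

lemma coset_mod [simp]: "B (a mod int n) = B a"
  by (auto simp: mem_coset_iff mod_mult_left_eq)

lemma mem_coset_self: "a \<in> {0..<int n} \<Longrightarrow> a \<in> B a"
  unfolding mem_coset_iff by (rule exI[of _ 0]) simp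

lemma coset_trans: "b \<in> B a \<Longrightarrow> c \<in> B b \<Longrightarrow> c \<in> B a"
  unfolding mem_coset_iff by (auto simp: mod_mult_left_eq mult.assoc simp flip: power_add)

lemma coset_sym:
  assumes "b \<in> B a" "a \<in> {0..<int n}"
  shows "a \<in> B b"
proof -
  obtain k where k: "b = (a * int q ^ k) mod int n" using assms(1) mem_coset_iff by auto
  \<comment> \<open>Going (m - 1) k steps further along the orbit makes mk steps in all, and q^(mk)
    = 1 modulo n, which returns to a.\<close>
  have "k + (m - 1) * k = m * k" using m_gt_0 by (cases m) auto
  then have "(b * int q ^ ((m - 1) * k)) mod int n = (a * (int q ^ m) ^ k) mod int n"
    by (simp add: k mod_mult_left_eq mult.assoc flip: power_add power_mult)
  also have "[a * (int q ^ m) ^ k = a * 1 ^ k] (mod int n)"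
    by (intro cong_scalar_left cong_pow order)
  then have "(a * (int q ^ m) ^ k) mod int n = a" using assms(2) by (simp add: cong_def)
  finally show ?thesis unfolding mem_coset_iff by metis
qed

lemma coset_eq:
  assumes "b \<in> B a"
  shows "B b = B a"
proof (intro equalityI subsetI)
  \<comment> \<open>\<open>a\<close> may be an unreduced integer such as \<open>- i j\<close>, so
    symmetry is applied to its residue.\<close>
  have 1: "a mod int n \<in> B b" using coset_sym[of b "a mod int n"] assms n_gt_0 by simp
  fix c assume "c \<in> B a"
  then show "c \<in> B b" using coset_trans[OF 1] by simp
qed (rule coset_trans[OF assms])

lemma neg_mem_coset: "b \<in> B a \<Longrightarrow> neg b \<in> B (- a)"
  unfolding mem_coset_iff by (auto simp: mod_minus_eq)

text \<open>Being a singleton is a congruence linear in a, so it passes to -a.\<close>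

lemma card_coset_eq_1_iff: "card (B a) = 1 \<longleftrightarrow> (a * int q) mod int n = a mod int n"
proof
  assume "card (B a) = 1"
  then obtain x where x: "B a = {x}" by (rule card_1_singletonE)
  have "a mod int n \<in> B a" unfolding mem_coset_iff by (rule exI[of _ 0]) simp
  moreover have "(a * int q) mod int n \<in> B a" unfolding mem_coset_iff by (rule exI[of _ 1]) simp
  ultimately show "(a * int q) mod int n = a mod int n" unfolding x by simp
next
  assume "(a * int q) mod int n = a mod int n"
  then have 1: "[a * int q = a] (mod int n)" by (simp add: cong_def)
  have "[a * int q ^ k = a] (mod int n)" for k
  proof (induction k)
    case (Suc k)
    have "[a * int q ^ k * int q = a * int q] (mod int n)"
      using Suc by (rule cong_scalar_right)
    then have "[a * int q ^ k * int q = a] (mod int n)" using 1 by (rule cong_trans)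
    then show ?case by (simp only: power_Suc2 mult.assoc)
  qed simp
  then have "B a = {a mod int n}" by (auto simp: mem_coset_iff cong_def)
  then show "card (B a) = 1" by simp
qed

lemma card_coset_minus: "card (B a) = 1 \<Longrightarrow> card (B (- a)) = 1"
proof -
  assume "card (B a) = 1"
  then have "[a * int q = a] (mod int n)" by (simp only: card_coset_eq_1_iff cong_def)
  then have "[- (a * int q) = - a] (mod int n)" by (simp only: cong_minus_minus_iff)
  then show ?thesis unfolding card_coset_eq_1_iff by (simp add: cong_def)
qed

end

section \<open>Combinatorics of index sets\<close>

lemma ex_subset_image_iff: "(\<exists>T \<subseteq> f ` A. P T) \<longleftrightarrow> (\<exists>S \<subseteq> A. P (f ` S))"
  by (auto simp: subset_image_iff)

text \<open>
  The index-level form of the statement: \<open>S\<close> is the index set of the zeros and \<open>\<nu>\<close> sends the index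
  of a coset to that of the opposite coset. Nothing prevents \<open>j \<in> S'\<close>; in that case \<open>S = S'\<close> is
  closed under \<open>\<nu>\<close>, and then \<open>\<nu> j\<close> is a second solution.
\<close>

lemma unique_defect_iff:
  assumes J: "\<And>j. j \<in> J \<Longrightarrow> \<nu> j \<in> J" and inv: "\<And>j. j \<in> J \<Longrightarrow> \<nu> (\<nu> j) = j"
    and P: "\<And>j. j \<in> J \<Longrightarrow> P j \<Longrightarrow> P (\<nu> j)" and S: "S \<subseteq> J"
  shows "(\<exists>!j. j \<in> J \<and> (P j \<and> \<nu> j \<noteq> j) \<and> (\<exists>S' \<subseteq> J. S = insert j S' \<and> (\<forall>h\<in>S'. \<nu> h \<in> S'))) \<longleftrightarrow>
    (\<exists>j. P j \<and> {j \<in> S. \<nu> j \<notin> S} = {j})" (is "(\<exists>!j. ?Q j) \<longleftrightarrow> ?R")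
proof
  assume ex1: "\<exists>!j. ?Q j"
  then obtain j where Qj: "?Q j" by blast
  then obtain S' where j: "j \<in> J" "P j" "\<nu> j \<noteq> j"
    and S': "S' \<subseteq> J" "S = insert j S'" "\<And>h. h \<in> S' \<Longrightarrow> \<nu> h \<in> S'" by blast
  have "j \<notin> S'"
  proof
    assume jS: "j \<in> S'"
    have "S = insert (\<nu> j) S'" using S' jS by blast
    then have "?Q (\<nu> j)" using j J[OF j(1)] inv[OF j(1)] P[OF j(1,2)] S'(1,3) by metis
    then show False using ex1 Qj j(3) by blast
  qed
  then have "\<nu> j \<notin> S" using S'(2) S'(3)[of "\<nu> j"] inv[OF j(1)] j(3) by auto
  then have "{j \<in> S. \<nu> j \<notin> S} = {j}" using S'(2,3) by auto
  then show ?R using j(2) by blast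
next
  assume ?R
  then obtain j where Pj: "P j" and A: "{j \<in> S. \<nu> j \<notin> S} = {j}" by blast
  have jS: "j \<in> S" "\<nu> j \<notin> S" using A by blast+
  have other: "\<nu> h \<in> S" if "h \<in> S" "h \<noteq> j" for h using A that by blast
  show "\<exists>!j. ?Q j"
  proof (rule ex1I[of _ j])
    have "\<nu> h \<in> S - {j}" if "h \<in> S - {j}" for h
    proof -
      \<comment> \<open>Were \<open>\<nu> h\<close> equal to j, then h would be
        \<open>\<nu> j\<close>, which is not in S. So S without j is closed.\<close>
      have "\<nu> h \<noteq> j" using inv[of h] that S jS(2) by auto
      then show ?thesis using other that by blast
    qed
    then have "\<exists>S' \<subseteq> J. S = insert j S' \<and> (\<forall>h\<in>S'. \<nu> h \<in> S')"
      using S jS(1) by (intro exI[of _ "S - {j}"]) blast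
    then show "?Q j" using S jS Pj by auto
  next
    fix j' assume "?Q j'"
    then obtain S' where S': "S = insert j' S'" "\<And>h. h \<in> S' \<Longrightarrow> \<nu> h \<in> S'" by blast
    show "j' = j"
    proof (rule ccontr)
      \<comment> \<open>Otherwise j would lie in the closed part S', and \<open>\<nu> j\<close>
        would be in S.\<close>
      assume "j' \<noteq> j"
      then have "j \<in> S'" using S'(1) jS(1) by blast
      then show False using S' jS(2) by blast
    qed
  qed
qed

section \<open>Coset leaders and opposite cosets\<close>

locale cyclotomic_leaders = cyclotomic_cosets +
  fixes t :: nat and i :: "nat \<Rightarrow> int"
  assumes leaders: "coset_leaders q n t i"
begin

lemma leader_range: "j \<in> {1..t} \<Longrightarrow> i j \<in> {0..<int n}"
  using leaders unfolding coset_leaders_def by blast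

lemma ex1_leader: "\<exists>!j. j \<in> {1..t} \<and> i j \<in> B a"
proof -
  have "a mod int n \<in> {0..<int n}" using n_gt_0 by simp
  then have "\<exists>!j. j \<in> {1..t} \<and> i j \<in> B (a mod int n)"
    using leaders unfolding coset_leaders_def by blast
  then show ?thesis by simp
qed

lemma leader_unique: "j \<in> {1..t} \<Longrightarrow> k \<in> {1..t} \<Longrightarrow> i j \<in> B (i k) \<Longrightarrow> j = k"
  using ex1_leader[of "i k"] mem_coset_self[OF leader_range] by blast

text \<open>The map induced on indices by negation of residues; it becomes the \<open>\<nu>\<close>
  of \<open>unique_defect_iff\<close>. The leader exists for every h because
  \<open>ex1_leader\<close> covers all integers.\<close>

definition opposite :: "nat \<Rightarrow> nat" where
  "opposite h = (THE k. k \<in> {1..t} \<and> i k \<in> B (- i h))"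

lemma opposite: "opposite h \<in> {1..t}" "i (opposite h) \<in> B (- i h)"
  using theI'[OF ex1_leader[of "- i h"]] unfolding opposite_def by blast+

lemma opposite_eqI: "k \<in> {1..t} \<Longrightarrow> i k \<in> B (- i h) \<Longrightarrow> opposite h = k"
  using ex1_leader[of "- i h"] opposite[of h] by blast

lemma opposite_opposite:
  assumes "h \<in> {1..t}"
  shows "opposite (opposite h) = h"
proof (rule opposite_eqI[OF assms])
  have "neg (i (opposite h)) \<in> B (i h)"
    using neg_mem_coset[OF opposite(2)[of h]] by simp
  then have "i h \<in> B (neg (i (opposite h)))"
    using coset_sym leader_range[OF assms] by blast
  then show "i h \<in> B (- i (opposite h))" by simp
qed

lemma card_coset_opposite: "card (B (i j)) = 1 \<Longrightarrow> card (B (i (opposite j))) = 1"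
  using card_coset_minus coset_eq[OF opposite(2)] by simp

text \<open>Two cosets are equal or disjoint, and equal cosets share their leader.\<close>

lemma disjoint_opposite_iff:
  assumes "j \<in> {1..t}"
  shows "B (i j) \<inter> B (- i j) = {} \<longleftrightarrow> opposite j \<noteq> j"
proof
  assume disj: "B (i j) \<inter> B (- i j) = {}"
  show "opposite j \<noteq> j"
  proof
    assume "opposite j = j"
    then have "i j \<in> B (- i j)" using opposite(2)[of j] by simp
    then show False using disj mem_coset_self[OF leader_range[OF assms]] by blast
  qed
next
  assume ne: "opposite j \<noteq> j"
  show "B (i j) \<inter> B (- i j) = {}"
  proof (rule ccontr)
    assume "B (i j) \<inter> B (- i j) \<noteq> {}"
    then obtain x where "x \<in> B (i j)" "x \<in> B (- i j)" by blast
    then have "B (i j) = B (- i j)" using coset_eq by metis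
    then have "i j \<in> B (- i j)" using mem_coset_self[OF leader_range[OF assms]] by simp
    then show False using opposite_eqI[OF assms] ne by simp
  qed
qed

text \<open>\<open>W\<close> stands for the set of exponents of the zeros of a cyclic code.\<close>

context
  fixes W :: "int set"
  assumes W: "W \<subseteq> {0..<int n}" and W_mult: "\<And>s. s \<in> W \<Longrightarrow> (s * int q) mod int n \<in> W"
begin

lemma coset_subset_W: "s \<in> W \<Longrightarrow> B s \<subseteq> W"
proof
  fix x assume s: "s \<in> W" and "x \<in> B s"
  then obtain k where k: "x = (s * int q ^ k) mod int n" using mem_coset_iff by auto
  have "(s * int q ^ k) mod int n \<in> W"
  proof (induction k)
    case 0
    then show ?case using s W by auto
  next
    case (Suc k)
    then show ?case using W_mult[OF Suc] by (simp add: mod_mult_right_eq mult_ac)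
  qed
  then show "x \<in> W" using k by simp
qed

lemma mem_W_cong: "x \<in> B s \<Longrightarrow> s \<in> {0..<int n} \<Longrightarrow> x \<in> W \<longleftrightarrow> s \<in> W"
  using coset_subset_W coset_sym by blast

definition index_set :: "nat set" where
  "index_set = {j \<in> {1..t}. i j \<in> W}"

lemma W_eq_UN: "W = (\<Union>j\<in>index_set. B (i j))"
proof (intro equalityI subsetI)
  fix s assume s: "s \<in> W"
  then have s': "s \<in> {0..<int n}" using W by blast
  obtain j where j: "j \<in> {1..t}" "i j \<in> B s" using ex1_leader[of s] by blast
  then have "i j \<in> W" using coset_subset_W[OF s] by blast
  moreover have "s \<in> B (i j)" using coset_sym[OF j(2) s'] .
  ultimately show "s \<in> (\<Union>j\<in>index_set. B (i j))" using j(1) by (auto simp: index_set_def)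
qed (use coset_subset_W in \<open>auto simp: index_set_def\<close>)

text \<open>Negation maps \<open>B (i j)\<close> into the opposite coset, and W consists of whole
  cosets, so membership of the opposite leader decides for all s in \<open>B (i j)\<close>.\<close>

lemma neg_mem_W_iff:
  assumes "j \<in> {1..t}" "s \<in> B (i j)"
  shows "neg s \<in> W \<longleftrightarrow> opposite j \<in> index_set"
proof -
  have r: "neg (i j) \<in> {0..<int n}" using n_gt_0 by simp
  have "neg s \<in> B (neg (i j))" using neg_mem_coset[OF assms(2)] by simp
  then have "neg s \<in> W \<longleftrightarrow> neg (i j) \<in> W" using mem_W_cong r by blast
  also have "\<dots> \<longleftrightarrow> i (opposite j) \<in> W"
    using mem_W_cong[OF _ r] opposite(2)[of j] by simp
  finally show ?thesis using opposite(1)[of j] by (simp add: index_set_def)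
qed

lemma defect_eq_UN:
  "{s \<in> W. neg s \<notin> W} = (\<Union>j\<in>{j \<in> index_set. opposite j \<notin> index_set}. B (i j))"
proof -
  have "s \<in> W \<and> neg s \<notin> W \<longleftrightarrow> (\<exists>j\<in>index_set. opposite j \<notin> index_set \<and> s \<in> B (i j))" for s
  proof -
    have "s \<in> W \<longleftrightarrow> (\<exists>j\<in>index_set. s \<in> B (i j))" using W_eq_UN by blast
    moreover have "neg s \<in> W \<longleftrightarrow> opposite j \<in> index_set" if "j \<in> index_set" "s \<in> B (i j)" for j
      using that neg_mem_W_iff by (simp add: index_set_def)
    ultimately show ?thesis by blast
  qed
  then show ?thesis by blast
qed

lemma card_defect_eq_1_iff:
  "card {s \<in> W. neg s \<notin> W} = 1 \<longleftrightarrow>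
    (\<exists>j. card (B (i j)) = 1 \<and> {j \<in> index_set. opposite j \<notin> index_set} = {j})"
  (is "card ?A = 1 \<longleftrightarrow> (\<exists>j. _ \<and> ?I = {j})")
proof
  assume "card ?A = 1"
  then obtain z where z: "?A = {z}" by (rule card_1_singletonE)
  \<comment> \<open>Each coset of the union lies in {z} and contains its own leader, so any two of
    them have the same leader z.\<close>
  have sing: "B (i j) = {z} \<and> i j = z" if "j \<in> ?I" for j
  proof -
    have "B (i j) \<subseteq> {z}" using z that unfolding defect_eq_UN by blast
    moreover have "i j \<in> B (i j)"
      using that by (intro mem_coset_self leader_range) (simp add: index_set_def)
    ultimately show ?thesis by blast
  qed
  obtain j where j: "j \<in> ?I" using z unfolding defect_eq_UN by blast
  have "?I = {j}"
  proof (intro equalityI subsetI)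
    fix k assume k: "k \<in> ?I"
    have "i k \<in> B (i j)"
      unfolding conjunct1[OF sing[OF j]] using sing[OF k] by simp
    then show "k \<in> {j}" using leader_unique[of k j] j k by (auto simp: index_set_def)
  qed (use j in blast)
  moreover have "card (B (i j)) = 1" unfolding conjunct1[OF sing[OF j]] by simp
  ultimately show "\<exists>j. card (B (i j)) = 1 \<and> ?I = {j}" by blast
next
  assume "\<exists>j. card (B (i j)) = 1 \<and> ?I = {j}"
  then obtain j where j: "card (B (i j)) = 1" "?I = {j}" by blast
  show "card ?A = 1" unfolding defect_eq_UN j(2) using j(1) by simp
qed

end

end

section \<open>Basic zeros\<close>

locale cyclotomic_embedding =
  root_of_unity_embedding emb \<alpha> n + cyclotomic_leaders "CARD('a)" n m t i
  for emb :: "'a :: {field, finite} \<Rightarrow> 'b :: field" and \<alpha> n m t i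
begin

text \<open>Lets sets of roots and sets of indices be exchanged freely.\<close>

lemma inj_on_alpha_leader: "inj_on (\<lambda>j. \<alpha> powi i j) {1..t}"
proof (rule inj_onI)
  fix j k assume jk: "j \<in> {1..t}" "k \<in> {1..t}" "\<alpha> powi i j = \<alpha> powi i k"
  then have "i j = i k" using leader_range[of j] leader_range[of k] by (simp add: alpha_powi_eq_iff)
  then show "j = k" using leader_unique[of j k] jk mem_coset_self[OF leader_range[of k]] by simp
qed

text \<open>Resolves the \<open>THE\<close> in \<open>basic_zeros\<close>: grouping the linear
  factors of the generator by cosets gives existence, and evaluating at the leaders gives
  uniqueness.\<close>

lemma basic_zeros_eq:
  assumes "is_generator_poly n D g" "D \<subseteq> carrier_vec n"
  shows "basic_zeros emb \<alpha> n t i D = (\<lambda>j. \<alpha> powi i j) ` index_set (zero_set g)"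
proof -
  let ?W = "zero_set g"
  let ?S = "index_set ?W"
  have W: "?W \<subseteq> {0..<int n}" by (auto simp: zero_set_def)
  have gen: "generator_poly n D = g" using generator_poly_eqI[OF assms(1) n_pos assms(2)] .
  have S: "?S \<subseteq> {1..t}" by (auto simp: index_set_def[OF W zero_set_mult_card])
  then have fS: "finite ?S" using finite_subset by blast
  have g: "map_poly emb g = (\<Prod>s\<in>?W. [:- (\<alpha> powi s), 1:])"
    using assms(1) unfolding is_generator_poly_def by (intro map_poly_eq_prod_zero_set) blast+
  also have "\<dots> = (\<Prod>j\<in>?S. min_poly_root CARD('a) n \<alpha> (i j))"
    unfolding min_poly_root_def
  proof (subst prod.UNION_disjoint[OF fS, symmetric])
    show "\<forall>j\<in>?S. \<forall>k\<in>?S. j \<noteq> k \<longrightarrow> B (i j) \<inter> B (i k) = {}"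
    proof (intro ballI impI, rule ccontr)
      fix j k assume jk: "j \<in> ?S" "k \<in> ?S" "j \<noteq> k" "B (i j) \<inter> B (i k) \<noteq> {}"
      then obtain x where "x \<in> B (i j)" "x \<in> B (i k)" by blast
      then have "B (i j) = B (i k)" using coset_eq by metis
      then show False using leader_unique[of j k] mem_coset_self[OF leader_range[of j]] S jk by blast
    qed
    show "(\<Prod>s\<in>?W. [:- (\<alpha> powi s), 1:]) = (\<Prod>s\<in>(\<Union>j\<in>?S. B (i j)). [:- (\<alpha> powi s), 1:])"
      by (rule arg_cong[OF W_eq_UN[OF W zero_set_mult_card]])
  qed simp
  finally have ex: "map_poly emb g = (\<Prod>j\<in>?S. min_poly_root CARD('a) n \<alpha> (i j))" .
  have uniq: "S' = ?S"
    if S': "S' \<subseteq> {1..t}"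
      and prod: "map_poly emb g = (\<Prod>j\<in>S'. min_poly_root CARD('a) n \<alpha> (i j))" for S'
  proof -
    have fS': "finite S'" using S' finite_subset by blast
    \<comment> \<open>The product over S' vanishes at the leader root of index j iff some coset
      indexed by S' contains \<open>i j\<close>, and only the coset of index j does.\<close>
    have "j \<in> S' \<longleftrightarrow> i j \<in> ?W" if j: "j \<in> {1..t}" for j
    proof -
      have "i j \<in> ?W \<longleftrightarrow> poly (map_poly emb g) (\<alpha> powi i j) = 0"
        using leader_range[OF j] by (simp add: zero_set_def eval_root_def)
      also have "\<dots> \<longleftrightarrow> (\<exists>k\<in>S'. \<exists>s\<in>B (i k). \<alpha> powi i j = \<alpha> powi s)"
        unfolding prod min_poly_root_def using fS' by (simp add: poly_prod)
      also have "\<dots> \<longleftrightarrow> (\<exists>k\<in>S'. \<exists>s\<in>B (i k). i j = s)"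
      proof -
        have "\<alpha> powi i j = \<alpha> powi s \<longleftrightarrow> i j = s" if "s \<in> B (i k)" for s k
          using that coset_subset[of "i k"] leader_range[OF j] by (auto simp: alpha_powi_eq_iff)
        then show ?thesis by blast
      qed
      also have "\<dots> \<longleftrightarrow> j \<in> S'"
        using leader_unique[OF j] mem_coset_self[OF leader_range[OF j]] S' by blast
      finally show ?thesis ..
    qed
    then show ?thesis using S' by (auto simp: index_set_def[OF W zero_set_mult_card])
  qed
  have "(THE S. S \<subseteq> {1..t} \<and>
      map_poly emb (generator_poly n D) = (\<Prod>j\<in>S. min_poly_root CARD('a) n \<alpha> (i j))) = ?S"
    unfolding gen
  proof (rule the_equality)
    show "?S \<subseteq> {1..t} \<and> map_poly emb g = (\<Prod>j\<in>?S. min_poly_root CARD('a) n \<alpha> (i j))"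
      using S ex ..
  qed (use uniq in blast)
  then show ?thesis unfolding basic_zeros_def by (rule arg_cong)
qed

end

section \<open>From roots to indices: assembling the equivalence\<close>

theorem theorem4:
  fixes C :: "'a :: {field, finite} vec set"
    and emb :: "'a \<Rightarrow> 'b :: field"
    and \<alpha> :: 'b
    and q m n t :: nat
    and i :: "nat \<Rightarrow> int"
    and B :: "int \<Rightarrow> int set"
    and T :: "'b set"
  assumes "q = CARD('a)"
    and "m \<ge> 1"
    and "n = q ^ m - 1"
    and "field_hom emb"
    and "primitive_root_of_unity n \<alpha>"
    and "cyclic_code n C"
    and "coset_leaders q n t i"
    and "B = cyc_coset q n"
    and "T = (\<lambda>j. \<alpha> powi i j) ` {1..t}"
  shows "hull_dim n C = 1 \<longleftrightarrow>
    (\<exists>!j. j \<in> {1..t} \<and>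
       (card (B (i j)) = 1 \<and> B (i j) \<inter> B (- i j) = {}) \<and>
       (\<exists>T1 \<subseteq> T.
          basic_zeros emb \<alpha> n t i (dual_code n C) = T1 \<union> {\<alpha> powi i j} \<and>
          (\<forall>h \<in> {1..t}. \<alpha> powi i h \<in> T1 \<longrightarrow>
             B (i h) = B (- i h) \<or>
             (\<exists>k \<in> {1..t}. i k \<in> B (- i h) \<and> \<alpha> powi i k \<in> T1))))"
proof -
  interpret field_hom emb by (fact assms(4))
  have q: "q > 1" using card_field_gt_1[where 'a = 'a] assms(1) by simp
  have "q ^ 1 \<le> q ^ m" using q assms(2) by (intro power_increasing) auto
  then have qm: "q ^ m = n + 1" "n > 0" using q assms(3) by auto
  \<comment> \<open>Since q = 0 in F_q and m is positive, n = q^m - 1 equals -1 there, and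
    \<open>emb\<close> keeps it nonzero.\<close>
  have "of_nat (q ^ m) = (0 :: 'a)"
    using assms(1,2) of_nat_card_eq_0[where 'a = 'a] by (simp add: power_0_left)
  then have "(of_nat n :: 'a) = - 1" unfolding qm by (simp add: eq_neg_iff_add_eq_0 add.commute)
  then have "emb (of_nat n) = emb (- 1)" by simp
  then have n0: "of_nat n \<noteq> (0 :: 'b)" by (simp add: hom_distribs)
  have "int q ^ m = int n + 1" using arg_cong[OF qm(1), of int] by simp
  then have ord: "[int q ^ m = 1] (mod int n)" by (simp add: cong_def)
  interpret cyclotomic_embedding emb \<alpha> n m t i
    using qm(2) assms(2,5,7) n0 ord by unfold_locales (simp_all add: assms(1))
  have D: "cyclic_code n (dual_code n C)" using assms(6) by (rule dual_code_cyclic)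
  then obtain g where g: "is_generator_poly n (dual_code n C) g"
    using generator_poly_exists qm(2) by blast
  define W where "W = zero_set g"
  have W: "W \<subseteq> {0..<int n}" by (auto simp: W_def zero_set_def)
  have W_mult: "(s * int CARD('a)) mod int n \<in> W" if "s \<in> W" for s
    using that zero_set_mult_card by (simp add: W_def)
  define S where "S = index_set W"
  have S: "S \<subseteq> {1..t}" by (auto simp: S_def index_set_def[OF W W_mult])
  let ?f = "\<lambda>j. \<alpha> powi i j"
  note inj = inj_on_alpha_leader
  have bz: "basic_zeros emb \<alpha> n t i (dual_code n C) = ?f ` S"
    unfolding S_def W_def
    by (rule basic_zeros_eq[OF g]) (auto simp: vec_module.orthogonal_complement_def)
  have Beq: "B = cyc_coset CARD('a) n" using assms(1,8) by simp
  \<comment> \<open>The alternative \<open>B (i h) = B (- i h)\<close> means that h is its own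
    opposite, so both alternatives together say that S' is closed under \<open>opposite\<close> at
    h.\<close>
  have closed: "B (i h) = B (- i h) \<or> (\<exists>k\<in>{1..t}. i k \<in> B (- i h) \<and> ?f k \<in> ?f ` S') \<longleftrightarrow>
      opposite h \<in> S'" if h: "h \<in> S'" and S': "S' \<subseteq> {1..t}" for h S'
  proof -
    have mem: "?f k \<in> ?f ` S' \<longleftrightarrow> k \<in> S'" if "k \<in> {1..t}" for k
      using inj_on_image_mem_iff[OF inj that S'] .
    show ?thesis
    proof
      assume "opposite h \<in> S'"
      then show "B (i h) = B (- i h) \<or> (\<exists>k\<in>{1..t}. i k \<in> B (- i h) \<and> ?f k \<in> ?f ` S')"
        using opposite[of h] unfolding Beq by blast
    next
      assume "B (i h) = B (- i h) \<or> (\<exists>k\<in>{1..t}. i k \<in> B (- i h) \<and> ?f k \<in> ?f ` S')"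
      then obtain k where k: "k \<in> S'" "i k \<in> B (- i h)"
      proof
        assume eq: "B (i h) = B (- i h)"
        have "i h \<in> B (i h)"
          unfolding Beq by (rule mem_coset_self[OF leader_range]) (use h S' in blast)
        then show thesis using that[OF h] eq by simp
      next
        assume "\<exists>k\<in>{1..t}. i k \<in> B (- i h) \<and> ?f k \<in> ?f ` S'"
        then show thesis using that mem by blast
      qed
      then have "opposite h = k" using S' unfolding Beq by (intro opposite_eqI) blast+
      then show "opposite h \<in> S'" using k(1) by simp
    qed
  qed
  have zeros: "(\<exists>T1 \<subseteq> T. basic_zeros emb \<alpha> n t i (dual_code n C) = T1 \<union> {\<alpha> powi i j} \<and>
          (\<forall>h \<in> {1..t}. \<alpha> powi i h \<in> T1 \<longrightarrow>
             B (i h) = B (- i h) \<or> (\<exists>k \<in> {1..t}. i k \<in> B (- i h) \<and> \<alpha> powi i k \<in> T1))) \<longleftrightarrow>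
      (\<exists>S' \<subseteq> {1..t}. S = insert j S' \<and> (\<forall>h\<in>S'. opposite h \<in> S'))" (is "?L \<longleftrightarrow> ?R")
    if j: "j \<in> {1..t}" for j
  proof -
    have eq: "?f ` S = ?f ` S' \<union> {?f j} \<longleftrightarrow> S = insert j S'" if "S' \<subseteq> {1..t}" for S'
      using inj_on_image_eq_iff[OF inj S, of "insert j S'"] that j by simp
    have all: "(\<forall>h \<in> {1..t}. ?f h \<in> ?f ` S' \<longrightarrow>
          B (i h) = B (- i h) \<or> (\<exists>k \<in> {1..t}. i k \<in> B (- i h) \<and> ?f k \<in> ?f ` S')) \<longleftrightarrow>
        (\<forall>h\<in>S'. opposite h \<in> S')" if S': "S' \<subseteq> {1..t}" for S'
    proof -
      have "(\<forall>h \<in> {1..t}. ?f h \<in> ?f ` S' \<longrightarrow> X h) \<longleftrightarrow> (\<forall>h\<in>S'. X h)" for X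
        using inj_on_image_mem_iff[OF inj _ S'] S' by blast
      then show ?thesis using closed[OF _ S'] by (simp only: cong: ball_cong)
    qed
    have "?L \<longleftrightarrow> (\<exists>S' \<subseteq> {1..t}. ?f ` S = ?f ` S' \<union> {?f j} \<and> (\<forall>h \<in> {1..t}. ?f h \<in> ?f ` S' \<longrightarrow>
          B (i h) = B (- i h) \<or> (\<exists>k \<in> {1..t}. i k \<in> B (- i h) \<and> ?f k \<in> ?f ` S')))"
      unfolding bz assms(9) by (rule ex_subset_image_iff)
    also have "\<dots> \<longleftrightarrow> ?R" by (rule ex_cong1, rule conj_cong[OF refl], simp only: eq all)
    finally show ?thesis .
  qed
  have "hull_dim n C = card {s \<in> W. neg s \<notin> W}"
    unfolding W_def by (rule hull_dim_eq[OF assms(6) g])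
  then have "hull_dim n C = 1 \<longleftrightarrow>
      (\<exists>j. card (B (i j)) = 1 \<and> {j \<in> S. opposite j \<notin> S} = {j})"
    using card_defect_eq_1_iff[OF W W_mult] unfolding Beq S_def by simp
  also have "\<dots> \<longleftrightarrow> (\<exists>!j. j \<in> {1..t} \<and> (card (B (i j)) = 1 \<and> opposite j \<noteq> j) \<and>
      (\<exists>S' \<subseteq> {1..t}. S = insert j S' \<and> (\<forall>h\<in>S'. opposite h \<in> S')))"
    unfolding Beq
    by (rule unique_defect_iff[symmetric]; (rule opposite(1) opposite_opposite card_coset_opposite S; assumption))
  finally have "hull_dim n C = 1 \<longleftrightarrow>
      (\<exists>!j. j \<in> {1..t} \<and> (card (B (i j)) = 1 \<and> opposite j \<noteq> j) \<and>
        (\<exists>S' \<subseteq> {1..t}. S = insert j S' \<and> (\<forall>h\<in>S'. opposite h \<in> S')))" .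
  also have "\<dots> \<longleftrightarrow> (\<exists>!j. j \<in> {1..t} \<and> (card (B (i j)) = 1 \<and> B (i j) \<inter> B (- i j) = {}) \<and>
       (\<exists>T1 \<subseteq> T. basic_zeros emb \<alpha> n t i (dual_code n C) = T1 \<union> {\<alpha> powi i j} \<and>
          (\<forall>h \<in> {1..t}. \<alpha> powi i h \<in> T1 \<longrightarrow>
             B (i h) = B (- i h) \<or> (\<exists>k \<in> {1..t}. i k \<in> B (- i h) \<and> \<alpha> powi i k \<in> T1))))"
  \<comment> \<open>The two bodies are compared for each j under the shared conjunct
    \<open>j \<in> {1..t}\<close>, which the translations of (i) and (ii) require.\<close>
  proof (rule arg_cong[where f = Ex1], rule ext, rule conj_cong[OF refl])
    fix j assume j: "j \<in> {1..t}"
    have "B (i j) \<inter> B (- i j) = {} \<longleftrightarrow> opposite j \<noteq> j"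
      using disjoint_opposite_iff[OF j] unfolding Beq .
    then show "(card (B (i j)) = 1 \<and> opposite j \<noteq> j) \<and>
        (\<exists>S' \<subseteq> {1..t}. S = insert j S' \<and> (\<forall>h\<in>S'. opposite h \<in> S')) \<longleftrightarrow>
        (card (B (i j)) = 1 \<and> B (i j) \<inter> B (- i j) = {}) \<and>
        (\<exists>T1 \<subseteq> T. basic_zeros emb \<alpha> n t i (dual_code n C) = T1 \<union> {\<alpha> powi i j} \<and>
          (\<forall>h \<in> {1..t}. \<alpha> powi i h \<in> T1 \<longrightarrow>
             B (i h) = B (- i h) \<or> (\<exists>k \<in> {1..t}. i k \<in> B (- i h) \<and> \<alpha> powi i k \<in> T1)))"
      unfolding zeros[OF j] by (simp only:)
  qed
  finally show ?thesis .
qed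

end
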